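(* Let $\mathbf{n}=(n_1,\dots,n_N)\in\mathbb{N}^N$, $n=\sum_{k=1}^N n_k$, $0\le d\le\min_k n_k$, let $p^{(k)}\in\mathcal{P}_{n_k}$ be real polynomials and $w^{(k)}\in[0,+\infty)^{n_k+1}$ weight vectors, $k=1,\dots,N$. For $\widehat h\in\mathcal{P}_d\setminus\{0\}$ such that each matrix $\mathrm{diag}(\sqrt{w^{(k)}})\,\mathbf{M}_{n_k-d}(\widehat h)$ has full column rank, let $$f_1(\widehat h)=\min_{\widehat g^{(k)}\in\mathcal{P}_{n_k-d},\,k=1,\dots,N}\ \sum_{k=1}^N\big\|\mathbf{M}_{n_k-d}(\widehat h)\,\widehat g^{(k)}-p^{(k)}\big\|_{w^{(k)}}^2,$$ let $\widehat g^{(k)}_*$ be the minimizers, and let $g_*(\widehat h)$ be the vector obtained by stacking $\mathrm{diag}(\sqrt{w^{(k)}})\big(p^{(k)}-\mathbf{M}_{n_k-d}(\widehat h)\widehat g^{(k)}_*\big)$, $k=1,\dots,N$ (so $f_1(\widehat h)=\|g_*(\widehat h)\|_2^2$). Then $f_1$, its gradient, the vector $g_*(\widehat h)$, and the Jacobian of $g_*$ with respect to $\widehat h$ can be evaluated in $O(d^2n)$ flops.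
   Context: $\mathcal{P}_m$ is the space of real polynomials of degree at most $m$, identified with coefficient vectors $[p_0\cdots p_m]^\top\in\mathbb{R}^{m+1}$. For $h\in\mathcal{P}_r$, $\mathbf{M}_m(h)\in\mathbb{R}^{(m+r+1)\times(m+1)}$ is the Toeplitz matrix with $(i,j)$ entry $h_{i-j}$ (zero if $i-j\notin\{0,\dots,r\}$), so $\mathbf{M}_m(h)q=h\cdot q$ for $q\in\mathcal{P}_m$. $\|y\|_w^2=\sum_jw_jy_j^2$. A flop is an elementary floating-point (real arithmetic) operation. *)

theory Defs
  imports Complex_Main "Jordan_Normal_Form.DL_Rank"
begin

section \<open>Weighted least squares with a common factor\<close>

text \<open>A polynomial of degree at most \<open>m\<close> is its coefficient vector
  \<open>(p\<^sub>0, \<dots>, p\<^sub>m) \<in> carrier_vec (m + 1)\<close>. The blocks \<open>k = 1, \<dots>, N\<close> are the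
  positions \<open>0, \<dots>, N - 1\<close> of lists: \<open>ns\<close> holds the degrees, \<open>ps\<close> the polynomials,
  \<open>ws\<close> the weights and \<open>gs\<close> the cofactors.\<close>

text \<open>For \<open>h \<in> carrier_vec (r + 1)\<close> this is the Toeplitz matrix with \<open>m + r + 1\<close> rows.\<close>

definition mult_mat :: "nat \<Rightarrow> real vec \<Rightarrow> real mat" where
  "mult_mat m h = mat (m + dim_vec h) (m + 1)
     (\<lambda>(i, j). if j \<le> i \<and> i - j < dim_vec h then h $ (i - j) else 0)"

definition sqrt_diag :: "real vec \<Rightarrow> real mat" where
  "sqrt_diag w = mat_diag (dim_vec w) (\<lambda>j. sqrt (w $ j))"

definition weighted_norm_sq :: "real vec \<Rightarrow> real vec \<Rightarrow> real" where
  "weighted_norm_sq w y = (\<Sum>j<dim_vec y. w $ j * (y $ j)\<^sup>2)"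

definition full_column_rank :: "real mat \<Rightarrow> bool" where
  "full_column_rank A \<longleftrightarrow> vec_space.rank (dim_row A) A = dim_col A"

definition cofactors :: "nat list \<Rightarrow> nat \<Rightarrow> real vec list set" where
  "cofactors ns d = {gs. list_all2 (\<lambda>m g. g \<in> carrier_vec (m - d + 1)) ns gs}"

definition cost ::
  "nat list \<Rightarrow> nat \<Rightarrow> real vec list \<Rightarrow> real vec list \<Rightarrow> real vec \<Rightarrow> real vec list \<Rightarrow> real" where
  "cost ns d ps ws h gs = (\<Sum>k<length ns.
     weighted_norm_sq (ws ! k) (mult_mat (ns ! k - d) h *\<^sub>v (gs ! k) - ps ! k))"

definition f1 :: "nat list \<Rightarrow> nat \<Rightarrow> real vec list \<Rightarrow> real vec list \<Rightarrow> real vec \<Rightarrow> real" where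
  "f1 ns d ps ws h = (LEAST c. c \<in> cost ns d ps ws h ` cofactors ns d)"

definition g_min ::
  "nat list \<Rightarrow> nat \<Rightarrow> real vec list \<Rightarrow> real vec list \<Rightarrow> real vec \<Rightarrow> real vec list" where
  "g_min ns d ps ws h = arg_min_on (cost ns d ps ws h) (cofactors ns d)"

definition g_star ::
  "nat list \<Rightarrow> nat \<Rightarrow> real vec list \<Rightarrow> real vec list \<Rightarrow> real vec \<Rightarrow> real vec" where
  "g_star ns d ps ws h = foldr (@\<^sub>v)
     (map (\<lambda>k. sqrt_diag (ws ! k) *\<^sub>v
        (ps ! k - mult_mat (ns ! k - d) h *\<^sub>v (g_min ns d ps ws h ! k))) [0..<length ns])
     vNil"

section \<open>Gradients and Jacobians in runtime-indexed dimension\<close>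

text \<open>The type \<open>real vec\<close> contains vectors of all dimensions and is therefore not a normed
  space, so Frechet differentiability on \<open>carrier_vec m\<close> is spelled out.\<close>

definition norm2 :: "real vec \<Rightarrow> real" where
  "norm2 x = sqrt (x \<bullet> x)"

definition has_gradient :: "(real vec \<Rightarrow> real) \<Rightarrow> real vec \<Rightarrow> real vec \<Rightarrow> bool" where
  "has_gradient f G h \<longleftrightarrow> dim_vec G = dim_vec h \<and>
     (\<forall>\<epsilon>>0. \<exists>\<delta>>0. \<forall>x \<in> carrier_vec (dim_vec h). norm2 (x - h) < \<delta> \<longrightarrow>
        \<bar>f x - f h - G \<bullet> (x - h)\<bar> \<le> \<epsilon> * norm2 (x - h))"

definition has_jacobian :: "(real vec \<Rightarrow> real vec) \<Rightarrow> real mat \<Rightarrow> real vec \<Rightarrow> bool" where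
  "has_jacobian F J h \<longleftrightarrow> J \<in> carrier_mat (dim_vec (F h)) (dim_vec h) \<and>
     (\<forall>i<dim_row J. has_gradient (\<lambda>x. F x $ i) (row J i) h)"

section \<open>Flop counts\<close>

text \<open>Straight-line programs over the reals. Every arithmetic instruction is one flop and
  appends its value to the registers; reading an input, a register or an integer constant is
  free. A program has no access to the real data except through its flops. Division by zero,
  the square root of a negative number and reading a nonexistent cell are errors (\<open>None\<close>), in
  contrast to the total HOL operations.\<close>

datatype operand = Const int | Input nat | Reg nat

datatype flop =
    Add operand operand
  | Sub operand operand
  | Mul operand operand
  | Div operand operand
  | Sqrt operand

fun fetch :: "real list \<Rightarrow> real list \<Rightarrow> operand \<Rightarrow> real option" where
  "fetch xs rs (Const c) = Some (of_int c)"
| "fetch xs rs (Input i) = (if i < length xs then Some (xs ! i) else None)"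
| "fetch xs rs (Reg i) = (if i < length rs then Some (rs ! i) else None)"

definition binary ::
  "(real \<Rightarrow> real \<Rightarrow> real option) \<Rightarrow> real option \<Rightarrow> real option \<Rightarrow> real option" where
  "binary f u v = Option.bind u (\<lambda>a. Option.bind v (f a))"

fun exec_flop :: "real list \<Rightarrow> real list \<Rightarrow> flop \<Rightarrow> real option" where
  "exec_flop xs rs (Add a b) = binary (\<lambda>u v. Some (u + v)) (fetch xs rs a) (fetch xs rs b)"
| "exec_flop xs rs (Sub a b) = binary (\<lambda>u v. Some (u - v)) (fetch xs rs a) (fetch xs rs b)"
| "exec_flop xs rs (Mul a b) = binary (\<lambda>u v. Some (u * v)) (fetch xs rs a) (fetch xs rs b)"
| "exec_flop xs rs (Div a b) =
     binary (\<lambda>u v. if v = 0 then None else Some (u / v)) (fetch xs rs a) (fetch xs rs b)"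
| "exec_flop xs rs (Sqrt a) =
     Option.bind (fetch xs rs a) (\<lambda>u. if u < 0 then None else Some (sqrt u))"

fun run :: "real list \<Rightarrow> flop list \<Rightarrow> real list \<Rightarrow> real list option" where
  "run xs [] rs = Some rs"
| "run xs (c # cs) rs = Option.bind (exec_flop xs rs c) (\<lambda>v. run xs cs (rs @ [v]))"

definition computes ::
  "flop list \<Rightarrow> operand list \<Rightarrow> real list \<Rightarrow> real list \<Rightarrow> bool" where
  "computes prog outs xs ys \<longleftrightarrow>
     (\<exists>rs. run xs prog [] = Some rs \<and> map (fetch xs rs) outs = map Some ys)"

end

theory Submission
  imports Defs
begin

text \<open>For one polynomial, let \<open>B(x) = diag(\<surd>w) M(x)\<close> and \<open>c = diag(\<surd>w) p\<close>, so that the cofactor \<open>g\<close>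
  minimizes \<open>\<parallel>c - B(x) g\<parallel>\<^sup>2\<close>; the blocks do not interact. Column \<open>j\<close> of \<open>B(x)\<close> is supported on the
  \<open>d + 1\<close> rows \<open>j, \<dots>, j + d\<close>. Hence the matrix \<open>B\<^sup>T B\<close> of the normal equations has bandwidth \<open>d\<close>, and
  full column rank makes it positive definite. Gaussian elimination then needs no pivoting, and
  so no branching, and it solves \<open>d + 1\<close> systems with this matrix in \<open>O(d\<^sup>2 n)\<close> flops
  (\<open>banded_solve\<close>).

  A single elimination step carries the linear algebra: a symmetric matrix is positive definite
  if and only if its first entry is positive and its Schur complement is positive definite
  (\<open>posdef_Suc_iff\<close>). Induction with this step shows that positive definite systems are
  solvable, that they remain positive definite under small perturbations, that their solutions
  vary continuously, and what solving them costs.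

  For the derivatives, let \<open>e = c - B(h) g(h)\<close> be the optimal residual at \<open>h\<close> and \<open>dB\<^sub>t\<close> the
  derivative of \<open>B\<close> with respect to \<open>x\<^sub>t\<close>. The normal equations at \<open>x\<close> and at \<open>h\<close> give exactly
  \<open>B(x)\<^sup>T B(x) (g(x) - g(h)) = \<Sum>\<^sub>t (x\<^sub>t - h\<^sub>t) (dB\<^sub>t\<^sup>T e - B(x)\<^sup>T dB\<^sub>t g(h))\<close>, and continuity of solutions
  turns this into the partial derivatives of \<open>g\<close> and of the residual
  (\<open>projected_residual_slopes\<close>). They come from \<open>d + 1\<close> systems with the same banded matrix at \<open>h\<close>.
  The gradient of \<open>f\<^sub>1 = \<parallel>g\<^sub>*\<parallel>\<^sup>2\<close> is twice the transposed Jacobian applied to \<open>g\<^sub>*\<close>.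

  For \<open>d = 0\<close> the bound allows no flop at all. In this case \<open>B(x)\<close> is square and invertible near
  \<open>h\<close>, the residual vanishes identically, and all results are zero.\<close>

section \<open>Positive definite systems and elimination\<close>

text \<open>Matrices and vectors are functions on natural numbers together with an explicit size. The size
  is then free to vary in an induction, and passing to the trailing submatrix is just \<open>Suc\<close>.\<close>

definition solves :: "nat \<Rightarrow> (nat \<Rightarrow> nat \<Rightarrow> real) \<Rightarrow> (nat \<Rightarrow> real) \<Rightarrow> (nat \<Rightarrow> real) \<Rightarrow> bool" where
  "solves m A x b \<longleftrightarrow> (\<forall>i<m. (\<Sum>j<m. A i j * x j) = b i)"

definition posdef :: "nat \<Rightarrow> (nat \<Rightarrow> nat \<Rightarrow> real) \<Rightarrow> bool" where
  "posdef m A \<longleftrightarrow> (\<forall>i<m. \<forall>j<m. A i j = A j i) \<and>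
     (\<forall>v. (\<exists>i<m. v i \<noteq> 0) \<longrightarrow> 0 < (\<Sum>i<m. \<Sum>j<m. v i * A i j * v j))"

text \<open>The matrix and the right-hand side that are left for the unknowns \<open>1, 2, \<dots>\<close> after row \<open>0\<close> has
  been used to eliminate the unknown \<open>0\<close>. They are shifted down to start at \<open>0\<close> again.\<close>

definition schur :: "(nat \<Rightarrow> nat \<Rightarrow> real) \<Rightarrow> nat \<Rightarrow> nat \<Rightarrow> real" where
  "schur A i j = A (Suc i) (Suc j) - A (Suc i) 0 * A 0 (Suc j) / A 0 0"

definition reduced_rhs :: "(nat \<Rightarrow> nat \<Rightarrow> real) \<Rightarrow> (nat \<Rightarrow> real) \<Rightarrow> nat \<Rightarrow> real" where
  "reduced_rhs A b i = b (Suc i) - A (Suc i) 0 * b 0 / A 0 0"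

lemma complete_square:
  assumes sym: "\<And>i. i < m \<Longrightarrow> A (Suc i) 0 = A 0 (Suc i)" and nz: "A 0 0 \<noteq> 0"
  shows "(\<Sum>i<Suc m. \<Sum>j<Suc m. v i * A i j * v j) =
    A 0 0 * (v 0 + (\<Sum>j<m. A 0 (Suc j) * v (Suc j)) / A 0 0)\<^sup>2
    + (\<Sum>i<m. \<Sum>j<m. v (Suc i) * schur A i j * v (Suc j))"
proof -
  define S where "S = (\<Sum>j<m. A 0 (Suc j) * v (Suc j))"
  define Q where "Q = (\<Sum>i<m. \<Sum>j<m. v (Suc i) * A (Suc i) (Suc j) * v (Suc j))"
  have row: "(\<Sum>j<m. v 0 * A 0 (Suc j) * v (Suc j)) = v 0 * S"
    by (simp add: S_def sum_distrib_left mult.assoc)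
  have col: "(\<Sum>i<m. v (Suc i) * A (Suc i) 0 * v 0) = v 0 * S"
    by (simp add: S_def sum_distrib_left sym mult_ac)
  have full: "(\<Sum>i<Suc m. \<Sum>j<Suc m. v i * A i j * v j) = A 0 0 * (v 0)\<^sup>2 + 2 * v 0 * S + Q"
    unfolding sum.lessThan_Suc_shift sum.distrib row col Q_def[symmetric]
    by (simp add: power2_eq_square)
  have "(\<Sum>i<m. \<Sum>j<m. v (Suc i) * (A (Suc i) 0 * A 0 (Suc j) / A 0 0) * v (Suc j))
      = (\<Sum>i<m. \<Sum>j<m. (A 0 (Suc i) * v (Suc i)) * (A 0 (Suc j) * v (Suc j)) / A 0 0)"
    by (intro sum.cong refl) (simp add: sym)
  also have "\<dots> = S * S / A 0 0"
    by (simp add: S_def sum_product sum_divide_distrib)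
  finally have rest: "(\<Sum>i<m. \<Sum>j<m. v (Suc i) * schur A i j * v (Suc j)) = Q - S * S / A 0 0"
    by (simp add: schur_def Q_def algebra_simps sum_subtractf)
  show ?thesis
    unfolding full S_def[symmetric] rest using nz by (simp add: power2_eq_square field_simps)
qed

lemma posdefI:
  assumes "\<And>i j. i < m \<Longrightarrow> j < m \<Longrightarrow> A i j = A j i"
    and "\<And>v i. i < m \<Longrightarrow> v i \<noteq> 0 \<Longrightarrow> 0 < (\<Sum>i<m. \<Sum>j<m. v i * A i j * v j)"
  shows "posdef m A"
  unfolding posdef_def using assms by blast

lemma posdef_sym: "posdef m A \<Longrightarrow> i < m \<Longrightarrow> j < m \<Longrightarrow> A i j = A j i"
  unfolding posdef_def by blast

lemma posdef_pos:
  assumes "posdef m A" "i < m" "v i \<noteq> 0"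
  shows "0 < (\<Sum>i<m. \<Sum>j<m. v i * A i j * v j)"
  using assms(1)[unfolded posdef_def, THEN conjunct2, rule_format, of v] assms(2,3) by blast

text \<open>By \<open>complete_square\<close>, the quadratic form is a square weighted by the pivot plus the form of the
  Schur complement, and the two summands can be controlled independently of each other. Hence
  elimination without pivoting never meets a zero pivot. Solvability, stability under
  perturbations, and the cost of solving are inductions on the size with this equivalence as the
  step.\<close>

lemma posdef_Suc_iff:
  assumes sym: "\<And>i j. i < Suc m \<Longrightarrow> j < Suc m \<Longrightarrow> A i j = A j i"
  shows "posdef (Suc m) A \<longleftrightarrow> 0 < A 0 0 \<and> posdef m (schur A)"
proof -
  have square: "(\<Sum>i<Suc m. \<Sum>j<Suc m. v i * A i j * v j) =
      A 0 0 * (v 0 + (\<Sum>j<m. A 0 (Suc j) * v (Suc j)) / A 0 0)\<^sup>2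
      + (\<Sum>i<m. \<Sum>j<m. v (Suc i) * schur A i j * v (Suc j))" if "0 < A 0 0" for v
    by (rule complete_square) (use sym[of "Suc _" 0] that in simp_all)
  show ?thesis
  proof
    assume pd: "posdef (Suc m) A"
    have "0 < (\<Sum>i<Suc m. \<Sum>j<Suc m. (if i = 0 then 1 else 0) * A i j * (if j = 0 then 1 else 0))"
      by (rule posdef_pos[OF pd, of 0]) simp_all
    then have pos: "0 < A 0 0"
      by (simp add: sum.lessThan_Suc_shift del: sum.lessThan_Suc)
    have "posdef m (schur A)"
    proof (rule posdefI)
      show "schur A i j = schur A j i" if "i < m" "j < m" for i j
        using sym[of "Suc i" "Suc j"] sym[of "Suc i" 0] sym[of 0 "Suc j"] that
        by (simp add: schur_def)
    next
      fix u :: "nat \<Rightarrow> real" and i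
      assume i: "i < m" "u i \<noteq> 0"
      \<comment> \<open>the value at \<open>0\<close> that minimizes the quadratic form for the given other coordinates\<close>
      define v where
        "v i = (case i of 0 \<Rightarrow> - (\<Sum>j<m. A 0 (Suc j) * u j) / A 0 0 | Suc i \<Rightarrow> u i)" for i
      have "0 < (\<Sum>i<Suc m. \<Sum>j<Suc m. v i * A i j * v j)"
        by (rule posdef_pos[OF pd, of "Suc i"]) (use i in \<open>simp_all add: v_def\<close>)
      also have "\<dots> = (\<Sum>i<m. \<Sum>j<m. u i * schur A i j * u j)"
        unfolding square[OF pos] by (simp add: v_def)
      finally show "0 < (\<Sum>i<m. \<Sum>j<m. u i * schur A i j * u j)" .
    qed
    with pos show "0 < A 0 0 \<and> posdef m (schur A)"
      by blast
  next
    assume *: "0 < A 0 0 \<and> posdef m (schur A)"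
    show "posdef (Suc m) A"
    proof (rule posdefI[OF sym])
      fix v :: "nat \<Rightarrow> real" and i
      assume i: "i < Suc m" "v i \<noteq> 0"
      let ?s = "v 0 + (\<Sum>j<m. A 0 (Suc j) * v (Suc j)) / A 0 0"
      let ?q = "\<Sum>i<m. \<Sum>j<m. v (Suc i) * schur A i j * v (Suc j)"
      have "0 < A 0 0 * ?s\<^sup>2 + ?q"
      proof (cases "\<exists>i<m. v (Suc i) \<noteq> 0")
        case True
        then obtain i where "i < m" "v (Suc i) \<noteq> 0" by blast
        then have "0 < ?q"
          using posdef_pos[of m "schur A" i "\<lambda>i. v (Suc i)"] * by simp
        with * show ?thesis
          by (simp add: add_nonneg_pos)
      next
        case False
        with i have "v 0 \<noteq> 0"
          by (cases i) auto
        with False * show ?thesis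
          by simp
      qed
      then show "0 < (\<Sum>i<Suc m. \<Sum>j<Suc m. v i * A i j * v j)"
        using square[of v] * by presburger
    qed
  qed
qed

lemma posdef_SucD:
  assumes "posdef (Suc m) A"
  shows "0 < A 0 0" "posdef m (schur A)"
proof -
  have "posdef (Suc m) A \<longleftrightarrow> 0 < A 0 0 \<and> posdef m (schur A)"
    by (rule posdef_Suc_iff) (rule posdef_sym[OF assms])
  with assms show "0 < A 0 0" "posdef m (schur A)"
    by blast+
qed

text \<open>One step of elimination, together with the back substitution that recovers the unknown \<open>0\<close>.\<close>

lemma solves_Suc_iff:
  assumes nz: "A 0 0 \<noteq> 0"
  shows "solves (Suc m) A x b \<longleftrightarrow>
    x 0 = (b 0 - (\<Sum>j<m. A 0 (Suc j) * x (Suc j))) / A 0 0 \<and>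
    solves m (schur A) (\<lambda>i. x (Suc i)) (reduced_rhs A b)"
proof -
  define S where "S = (\<Sum>j<m. A 0 (Suc j) * x (Suc j))"
  have first: "A 0 0 * x 0 + S = b 0 \<longleftrightarrow> x 0 = (b 0 - S) / A 0 0"
    using nz by (auto simp: field_simps)
  have later: "A (Suc i) 0 * x 0 + (\<Sum>j<m. A (Suc i) (Suc j) * x (Suc j)) = b (Suc i) \<longleftrightarrow>
      (\<Sum>j<m. schur A i j * x (Suc j)) = reduced_rhs A b i" if "x 0 = (b 0 - S) / A 0 0" for i
  proof -
    have "(\<Sum>j<m. schur A i j * x (Suc j))
        = (\<Sum>j<m. A (Suc i) (Suc j) * x (Suc j)) - A (Suc i) 0 * S / A 0 0"
      by (simp add: schur_def S_def left_diff_distrib sum_subtractf sum_distrib_left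
          sum_divide_distrib mult.assoc)
    then show ?thesis
      unfolding that reduced_rhs_def by (auto simp: diff_divide_distrib right_diff_distrib)
  qed
  show ?thesis
    unfolding solves_def All_less_Suc2 sum.lessThan_Suc_shift comp_def
    unfolding S_def[symmetric]
  proof (cases "x 0 = (b 0 - S) / A 0 0")
    case True
    then show "(A 0 0 * x 0 + S = b 0 \<and>
        (\<forall>i<m. A (Suc i) 0 * x 0 + (\<Sum>j<m. A (Suc i) (Suc j) * x (Suc j)) = b (Suc i))) \<longleftrightarrow>
      x 0 = (b 0 - S) / A 0 0 \<and> (\<forall>i<m. (\<Sum>j<m. schur A i j * x (Suc j)) = reduced_rhs A b i)"
      using first later[OF True] by simp
  next
    case False
    then show "(A 0 0 * x 0 + S = b 0 \<and>
        (\<forall>i<m. A (Suc i) 0 * x 0 + (\<Sum>j<m. A (Suc i) (Suc j) * x (Suc j)) = b (Suc i))) \<longleftrightarrow>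
      x 0 = (b 0 - S) / A 0 0 \<and> (\<forall>i<m. (\<Sum>j<m. schur A i j * x (Suc j)) = reduced_rhs A b i)"
      using first by simp
  qed
qed

lemma posdef_solution_exists:
  assumes "posdef m A"
  shows "\<exists>x. solves m A x b"
  using assms
proof (induction m arbitrary: A b)
  case 0
  then show ?case by (simp add: solves_def)
next
  case (Suc m)
  note pd = posdef_SucD[OF Suc.prems]
  obtain y where y: "solves m (schur A) y (reduced_rhs A b)"
    using Suc.IH[OF pd(2)] by blast
  have "solves (Suc m) A
      (\<lambda>i. case i of 0 \<Rightarrow> (b 0 - (\<Sum>j<m. A 0 (Suc j) * y j)) / A 0 0 | Suc i \<Rightarrow> y i) b"
    by (subst solves_Suc_iff) (use pd y in auto)
  then show ?case by blast
qed

lemma posdef_solution_unique: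
  assumes "posdef m A" "solves m A x b" "solves m A y b" "i < m"
  shows "x i = y i"
proof (rule ccontr)
  assume "x i \<noteq> y i"
  then have "0 < (\<Sum>i<m. \<Sum>j<m. (x i - y i) * A i j * (x j - y j))"
    using posdef_pos[OF assms(1,4), of "\<lambda>i. x i - y i"] by simp
  also have "\<dots> = (\<Sum>i<m. (x i - y i) * ((\<Sum>j<m. A i j * x j) - (\<Sum>j<m. A i j * y j)))"
    by (simp add: sum_distrib_left sum_subtractf[symmetric] algebra_simps)
  also have "\<dots> = 0"
    using assms(2,3) by (simp add: solves_def)
  finally show False by simp
qed

text \<open>Positive definiteness of a fixed size is an open condition: the first pivot stays positive,
  and the Schur complement is a continuous function of the matrix.\<close>

lemma posdef_eventually:
  assumes "posdef m A" "\<And>i j. i < m \<Longrightarrow> j < m \<Longrightarrow> ((\<lambda>x. B x i j) \<longlongrightarrow> A i j) F"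
    and "\<forall>\<^sub>F x in F. \<forall>i<m. \<forall>j<m. B x i j = B x j i"
  shows "\<forall>\<^sub>F x in F. posdef m (B x)"
  using assms
proof (induction m arbitrary: A B)
  case 0
  then show ?case by (simp add: posdef_def)
next
  case (Suc m)
  note pd = posdef_SucD[OF Suc.prems(1)]
  have pos: "\<forall>\<^sub>F x in F. 0 < B x 0 0"
    using order_tendstoD(1)[OF Suc.prems(2)[of 0 0] pd(1)] by simp
  have "\<forall>\<^sub>F x in F. posdef m (schur (B x))"
  proof (rule Suc.IH[OF pd(2)])
    show "((\<lambda>x. schur (B x) i j) \<longlongrightarrow> schur A i j) F" if "i < m" "j < m" for i j
      unfolding schur_def using that pd(1) by (intro tendsto_intros Suc.prems(2)) auto
    show "\<forall>\<^sub>F x in F. \<forall>i<m. \<forall>j<m. schur (B x) i j = schur (B x) j i"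
      using Suc.prems(3) by eventually_elim (auto simp: schur_def mult.commute)
  qed
  with pos Suc.prems(3) show ?case
    by eventually_elim (simp add: posdef_Suc_iff)
qed

text \<open>Solutions depend continuously on the data, because elimination and back substitution are
  rational operations whose denominators are the pivots.\<close>

lemma solution_tendsto:
  assumes "posdef m A" "\<And>i j. i < m \<Longrightarrow> j < m \<Longrightarrow> ((\<lambda>x. B x i j) \<longlongrightarrow> A i j) F"
    and "\<And>i. i < m \<Longrightarrow> ((\<lambda>x. c x i) \<longlongrightarrow> b i) F"
    and "\<forall>\<^sub>F x in F. solves m (B x) (z x) (c x)" "solves m A y b" "i < m"
  shows "((\<lambda>x. z x i) \<longlongrightarrow> y i) F"
  using assms
proof (induction m arbitrary: A B b c z y i)
  case 0
  then show ?case by blast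
next
  case (Suc m)
  note pd = posdef_SucD[OF Suc.prems(1)]
  have "\<forall>\<^sub>F x in F. B x 0 0 \<noteq> 0"
    using tendsto_imp_eventually_ne[OF Suc.prems(2)[of 0 0]] pd(1) by simp
  with Suc.prems(4) have ev: "\<forall>\<^sub>F x in F.
      z x 0 = (c x 0 - (\<Sum>j<m. B x 0 (Suc j) * z x (Suc j))) / B x 0 0 \<and>
      solves m (schur (B x)) (\<lambda>i. z x (Suc i)) (reduced_rhs (B x) (c x))"
    by eventually_elim (use solves_Suc_iff in blast)
  have y: "y 0 = (b 0 - (\<Sum>j<m. A 0 (Suc j) * y (Suc j))) / A 0 0"
      "solves m (schur A) (\<lambda>i. y (Suc i)) (reduced_rhs A b)"
    using solves_Suc_iff[THEN iffD1, OF _ Suc.prems(5)] pd(1) by (metis less_irrefl)+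
  have tail: "((\<lambda>x. z x (Suc i)) \<longlongrightarrow> y (Suc i)) F" if "i < m" for i
  proof (rule Suc.IH[OF pd(2) _ _ _ y(2) that])
    show "((\<lambda>x. schur (B x) i j) \<longlongrightarrow> schur A i j) F" if "i < m" "j < m" for i j
      unfolding schur_def using that pd(1) by (intro tendsto_intros Suc.prems(2)) auto
    show "((\<lambda>x. reduced_rhs (B x) (c x) i) \<longlongrightarrow> reduced_rhs A b i) F" if "i < m" for i
      unfolding reduced_rhs_def using that pd(1)
      by (intro tendsto_intros Suc.prems(2) Suc.prems(3)) auto
    show "\<forall>\<^sub>F x in F. solves m (schur (B x)) (\<lambda>i. z x (Suc i)) (reduced_rhs (B x) (c x))"
      using ev by eventually_elim simp
  qed
  show ?case
  proof (cases i)
    case 0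
    have "((\<lambda>x. (c x 0 - (\<Sum>j<m. B x 0 (Suc j) * z x (Suc j))) / B x 0 0) \<longlongrightarrow> y 0) F"
      unfolding y(1) using pd(1) by (intro tendsto_intros Suc.prems(2) Suc.prems(3) tail) auto
    moreover have "\<forall>\<^sub>F x in F. (c x 0 - (\<Sum>j<m. B x 0 (Suc j) * z x (Suc j))) / B x 0 0 = z x i"
      using ev unfolding 0 by eventually_elim simp
    ultimately show ?thesis
      unfolding 0 by (rule Lim_transform_eventually)
  next
    case (Suc i')
    with tail Suc.prems(6) show ?thesis by simp
  qed
qed

section \<open>Differentiability by slopes\<close>

text \<open>Vectors of all dimensions share one type, so this type carries no topology. The filter of
  neighbourhoods within the space of vectors of the same dimension gives access to the calculus
  of limits.\<close>

definition vec_nhds :: "real vec \<Rightarrow> real vec filter" where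
  "vec_nhds h = (INF \<delta>\<in>{0<..}. principal {x \<in> carrier_vec (dim_vec h). norm2 (x - h) < \<delta>})"

lemma eventually_vec_nhds:
  "eventually P (vec_nhds h) \<longleftrightarrow>
    (\<exists>\<delta>>0. \<forall>x\<in>carrier_vec (dim_vec h). norm2 (x - h) < \<delta> \<longrightarrow> P x)"
proof -
  have "eventually P (vec_nhds h) \<longleftrightarrow> (\<exists>\<delta>\<in>{0<..}.
      eventually P (principal {x \<in> carrier_vec (dim_vec h). norm2 (x - h) < \<delta>}))"
    unfolding vec_nhds_def
  proof (rule eventually_INF_base)
    fix a b :: real
    assume "a \<in> {0<..}" "b \<in> {0<..}"
    then show "\<exists>x\<in>{0<..}. principal {y \<in> carrier_vec (dim_vec h). norm2 (y - h) < x} \<le>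
        inf (principal {x \<in> carrier_vec (dim_vec h). norm2 (x - h) < a})
          (principal {x \<in> carrier_vec (dim_vec h). norm2 (x - h) < b})"
      by (intro bexI[of _ "min a b"]) auto
  qed auto
  then show ?thesis
    by (auto simp: eventually_principal)
qed

lemma has_gradient_alt:
  "has_gradient f G h \<longleftrightarrow> dim_vec G = dim_vec h \<and>
    (\<forall>\<epsilon>>0. \<forall>\<^sub>F x in vec_nhds h. \<bar>f x - f h - G \<bullet> (x - h)\<bar> \<le> \<epsilon> * norm2 (x - h))"
  unfolding has_gradient_def eventually_vec_nhds by blast

lemma eventually_vec_nhds_carrier: "\<forall>\<^sub>F x in vec_nhds h. x \<in> carrier_vec (dim_vec h)"
  unfolding eventually_vec_nhds by (auto intro: exI[of _ 1])

lemma norm2_zero: "norm2 (0\<^sub>v n) = 0"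
  by (simp add: norm2_def)

lemma eventually_vec_nhds_self: "eventually P (vec_nhds h) \<Longrightarrow> P h"
  unfolding eventually_vec_nhds
  by (metis carrier_vec_dim_vec minus_cancel_vec norm2_zero)

lemma abs_coord_le_norm2:
  assumes "x \<in> carrier_vec (dim_vec h)" "t < dim_vec h"
  shows "\<bar>x $ t - h $ t\<bar> \<le> norm2 (x - h)"
proof -
  have "(x $ t - h $ t)\<^sup>2 \<le> (\<Sum>t<dim_vec h. (x $ t - h $ t)\<^sup>2)"
    using assms by (intro member_le_sum) auto
  also have "\<dots> = (x - h) \<bullet> (x - h)"
    by (simp add: scalar_prod_def power2_eq_square atLeast0LessThan)
  finally show ?thesis
    unfolding norm2_def by (metis real_sqrt_abs real_sqrt_le_mono)
qed

lemma tendsto_coord: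
  assumes "t < dim_vec h"
  shows "((\<lambda>x. x $ t) \<longlongrightarrow> h $ t) (vec_nhds h)"
proof (rule tendstoI)
  fix e :: real
  assume "0 < e"
  then show "\<forall>\<^sub>F x in vec_nhds h. dist (x $ t) (h $ t) < e"
    unfolding eventually_vec_nhds dist_real_def
    using abs_coord_le_norm2[OF _ assms] by (intro exI[of _ e]) fastforce
qed

text \<open>Caratheodory's form of differentiability: the increment of \<open>f\<close> is a linear combination of the
  increments of the coordinates with coefficients \<open>q\<^sub>t(x)\<close> that converge to the partial
  derivatives. It is an equation instead of an estimate, so calculating with it is algebra
  followed by a passage to the limit.\<close>

definition has_slopes :: "(real vec \<Rightarrow> real) \<Rightarrow> (nat \<Rightarrow> real) \<Rightarrow> real vec \<Rightarrow> bool" where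
  "has_slopes f D h \<longleftrightarrow> (\<exists>q. (\<forall>t<dim_vec h. (q t \<longlongrightarrow> D t) (vec_nhds h)) \<and>
     (\<forall>\<^sub>F x in vec_nhds h. f x - f h = (\<Sum>t<dim_vec h. q t x * (x $ t - h $ t))))"

lemma has_slopes_imp_has_gradient:
  assumes "has_slopes f D h"
  shows "has_gradient f (vec (dim_vec h) D) h"
  unfolding has_gradient_alt
proof (intro conjI allI impI)
  fix \<epsilon> :: real
  assume "0 < \<epsilon>"
  from assms obtain q where q: "\<And>t. t < dim_vec h \<Longrightarrow> (q t \<longlongrightarrow> D t) (vec_nhds h)"
      and eq: "\<forall>\<^sub>F x in vec_nhds h. f x - f h = (\<Sum>t<dim_vec h. q t x * (x $ t - h $ t))"
    unfolding has_slopes_def by blast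
  have "((\<lambda>x. \<Sum>t<dim_vec h. \<bar>q t x - D t\<bar>) \<longlongrightarrow> (\<Sum>t<dim_vec h. \<bar>D t - D t\<bar>)) (vec_nhds h)"
    by (intro tendsto_intros q) simp
  then have "\<forall>\<^sub>F x in vec_nhds h. (\<Sum>t<dim_vec h. \<bar>q t x - D t\<bar>) < \<epsilon>"
    using \<open>0 < \<epsilon>\<close> by (intro order_tendstoD) simp_all
  with eq eventually_vec_nhds_carrier[of h]
  show "\<forall>\<^sub>F x in vec_nhds h. \<bar>f x - f h - vec (dim_vec h) D \<bullet> (x - h)\<bar> \<le> \<epsilon> * norm2 (x - h)"
  proof eventually_elim
    case (elim x)
    have "f x - f h - vec (dim_vec h) D \<bullet> (x - h) = (\<Sum>t<dim_vec h. (q t x - D t) * (x $ t - h $ t))"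
      using elim by (simp add: scalar_prod_def atLeast0LessThan sum_subtractf left_diff_distrib)
    also have "\<bar>\<dots>\<bar> \<le> (\<Sum>t<dim_vec h. \<bar>q t x - D t\<bar> * \<bar>x $ t - h $ t\<bar>)"
      using sum_abs[of "\<lambda>t. (q t x - D t) * (x $ t - h $ t)"] by (simp add: abs_mult)
    also have "\<dots> \<le> (\<Sum>t<dim_vec h. \<bar>q t x - D t\<bar> * norm2 (x - h))"
      using elim(2) abs_coord_le_norm2 by (intro sum_mono mult_left_mono) auto
    also have "\<dots> = (\<Sum>t<dim_vec h. \<bar>q t x - D t\<bar>) * norm2 (x - h)"
      by (simp add: sum_distrib_right)
    also have "\<dots> \<le> \<epsilon> * norm2 (x - h)"
      using elim(3) by (intro mult_right_mono) (auto simp: norm2_def scalar_prod_def intro: sum_nonneg)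
    finally show ?case .
  qed
qed simp

lemma has_slopes_cong:
  assumes "has_slopes f D h" "\<forall>\<^sub>F x in vec_nhds h. g x = f x"
  shows "has_slopes g D h"
proof -
  have self: "g h = f h"
    using eventually_vec_nhds_self[OF assms(2)] .
  from assms obtain q where q: "\<forall>t<dim_vec h. (q t \<longlongrightarrow> D t) (vec_nhds h)"
      and "\<forall>\<^sub>F x in vec_nhds h. f x - f h = (\<Sum>t<dim_vec h. q t x * (x $ t - h $ t))"
    unfolding has_slopes_def by blast
  from this(2) assms(2)
  have "\<forall>\<^sub>F x in vec_nhds h. g x - g h = (\<Sum>t<dim_vec h. q t x * (x $ t - h $ t))"
    by eventually_elim (simp add: self)
  with q show ?thesis
    unfolding has_slopes_def by blast
qed

lemma has_slopes_tendsto: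
  assumes "has_slopes f D h"
  shows "(f \<longlongrightarrow> f h) (vec_nhds h)"
proof -
  from assms obtain q where q: "\<And>t. t < dim_vec h \<Longrightarrow> (q t \<longlongrightarrow> D t) (vec_nhds h)"
      and eq: "\<forall>\<^sub>F x in vec_nhds h. f x - f h = (\<Sum>t<dim_vec h. q t x * (x $ t - h $ t))"
    unfolding has_slopes_def by blast
  have "((\<lambda>x. f h + (\<Sum>t<dim_vec h. q t x * (x $ t - h $ t))) \<longlongrightarrow>
      f h + (\<Sum>t<dim_vec h. D t * (h $ t - h $ t))) (vec_nhds h)"
    by (intro tendsto_intros tendsto_coord q) simp_all
  then have "((\<lambda>x. f h + (\<Sum>t<dim_vec h. q t x * (x $ t - h $ t))) \<longlongrightarrow> f h) (vec_nhds h)"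
    by simp
  moreover have "\<forall>\<^sub>F x in vec_nhds h. f h + (\<Sum>t<dim_vec h. q t x * (x $ t - h $ t)) = f x"
    using eq by eventually_elim (simp add: algebra_simps)
  ultimately show ?thesis
    by (rule Lim_transform_eventually)
qed

lemma has_slopes_square:
  assumes "has_slopes f D h"
  shows "has_slopes (\<lambda>x. (f x)\<^sup>2) (\<lambda>t. 2 * (f h * D t)) h"
proof -
  from assms obtain q where q: "\<And>t. t < dim_vec h \<Longrightarrow> (q t \<longlongrightarrow> D t) (vec_nhds h)"
      and eq: "\<forall>\<^sub>F x in vec_nhds h. f x - f h = (\<Sum>t<dim_vec h. q t x * (x $ t - h $ t))"
    unfolding has_slopes_def by blast
  have "((\<lambda>x. (f x + f h) * q t x) \<longlongrightarrow> (f h + f h) * D t) (vec_nhds h)" if "t < dim_vec h" for t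
    by (intro tendsto_intros has_slopes_tendsto[OF assms] q that)
  moreover have "\<forall>\<^sub>F x in vec_nhds h. (f x)\<^sup>2 - (f h)\<^sup>2 =
      (\<Sum>t<dim_vec h. (f x + f h) * q t x * (x $ t - h $ t))"
    using eq
  proof eventually_elim
    case (elim x)
    have "(f x)\<^sup>2 - (f h)\<^sup>2 = (f x + f h) * (f x - f h)"
      by (simp add: power2_eq_square algebra_simps)
    then show ?case
      unfolding elim by (simp add: sum_distrib_left mult.assoc)
  qed
  ultimately show ?thesis
    unfolding has_slopes_def by (intro exI[of _ "\<lambda>t x. (f x + f h) * q t x"]) (simp add: algebra_simps)
qed

lemma has_slopes_sum:
  assumes "finite K" "\<And>k. k \<in> K \<Longrightarrow> has_slopes (f k) (D k) h"
  shows "has_slopes (\<lambda>x. \<Sum>k\<in>K. f k x) (\<lambda>t. \<Sum>k\<in>K. D k t) h"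
proof -
  have "\<forall>k. \<exists>q. k \<in> K \<longrightarrow> (\<forall>t<dim_vec h. (q t \<longlongrightarrow> D k t) (vec_nhds h)) \<and>
      (\<forall>\<^sub>F x in vec_nhds h. f k x - f k h = (\<Sum>t<dim_vec h. q t x * (x $ t - h $ t)))"
    using assms(2) unfolding has_slopes_def by simp
  from choice[OF this] obtain q where
      q: "\<And>k t. k \<in> K \<Longrightarrow> t < dim_vec h \<Longrightarrow> (q k t \<longlongrightarrow> D k t) (vec_nhds h)"
      and eq: "\<And>k. k \<in> K \<Longrightarrow>
        \<forall>\<^sub>F x in vec_nhds h. f k x - f k h = (\<Sum>t<dim_vec h. q k t x * (x $ t - h $ t))"
    by blast
  have "((\<lambda>x. \<Sum>k\<in>K. q k t x) \<longlongrightarrow> (\<Sum>k\<in>K. D k t)) (vec_nhds h)" if "t < dim_vec h" for t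
    by (intro tendsto_intros q that)
  moreover have "\<forall>\<^sub>F x in vec_nhds h. \<forall>k\<in>K.
      f k x - f k h = (\<Sum>t<dim_vec h. q k t x * (x $ t - h $ t))"
    using assms(1) eq by (simp add: eventually_ball_finite)
  then have "\<forall>\<^sub>F x in vec_nhds h. (\<Sum>k\<in>K. f k x) - (\<Sum>k\<in>K. f k h) =
      (\<Sum>t<dim_vec h. (\<Sum>k\<in>K. q k t x) * (x $ t - h $ t))"
  proof eventually_elim
    case (elim x)
    then have "(\<Sum>k\<in>K. f k x) - (\<Sum>k\<in>K. f k h) =
        (\<Sum>k\<in>K. \<Sum>t<dim_vec h. q k t x * (x $ t - h $ t))"
      by (simp add: sum_subtractf[symmetric])
    also have "\<dots> = (\<Sum>t<dim_vec h. (\<Sum>k\<in>K. q k t x) * (x $ t - h $ t))"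
      by (subst sum.swap) (simp add: sum_distrib_right)
    finally show ?case .
  qed
  ultimately show ?thesis
    unfolding has_slopes_def by (intro exI[of _ "\<lambda>t x. \<Sum>k\<in>K. q k t x"]) blast
qed

section \<open>Linear least squares and variable projection\<close>

definition gram :: "nat \<Rightarrow> (nat \<Rightarrow> nat \<Rightarrow> real) \<Rightarrow> nat \<Rightarrow> nat \<Rightarrow> real" where
  "gram r B j l = (\<Sum>i<r. B i j * B i l)"

definition residual :: "nat \<Rightarrow> (nat \<Rightarrow> nat \<Rightarrow> real) \<Rightarrow> (nat \<Rightarrow> real) \<Rightarrow> (nat \<Rightarrow> real) \<Rightarrow> nat \<Rightarrow> real" where
  "residual m B c g i = c i - (\<Sum>l<m. B i l * g l)"

definition normal_eq ::
  "nat \<Rightarrow> nat \<Rightarrow> (nat \<Rightarrow> nat \<Rightarrow> real) \<Rightarrow> (nat \<Rightarrow> real) \<Rightarrow> (nat \<Rightarrow> real) \<Rightarrow> bool" where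
  "normal_eq r m B c g \<longleftrightarrow> solves m (gram r B) g (\<lambda>j. \<Sum>i<r. B i j * c i)"

lemma gram_mult: "(\<Sum>l<m. gram r B j l * g l) = (\<Sum>i<r. B i j * (\<Sum>l<m. B i l * g l))"
  unfolding gram_def sum_distrib_left sum_distrib_right
  by (subst sum.swap) (simp add: mult.assoc)

lemma normal_eq_iff:
  "normal_eq r m B c g \<longleftrightarrow> (\<forall>j<m. (\<Sum>i<r. B i j * residual m B c g i) = 0)"
  unfolding normal_eq_def solves_def gram_mult residual_def right_diff_distrib sum_subtractf
    right_minus_eq
  by auto

lemma gram_quadratic:
  "(\<Sum>j<m. \<Sum>l<m. v j * gram r B j l * v l) = (\<Sum>i<r. (\<Sum>l<m. B i l * v l)\<^sup>2)"
proof -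
  have "(\<Sum>j<m. \<Sum>l<m. v j * gram r B j l * v l) = (\<Sum>j<m. v j * (\<Sum>l<m. gram r B j l * v l))"
    by (simp add: sum_distrib_left mult.assoc)
  also have "\<dots> = (\<Sum>j<m. \<Sum>i<r. B i j * v j * (\<Sum>l<m. B i l * v l))"
    unfolding gram_mult by (simp add: sum_distrib_left mult_ac)
  also have "\<dots> = (\<Sum>i<r. (\<Sum>l<m. B i l * v l)\<^sup>2)"
    by (subst sum.swap) (simp add: power2_eq_square sum_distrib_right)
  finally show ?thesis .
qed

lemma gram_sym: "gram r B j l = gram r B l j"
  by (simp add: gram_def mult.commute)

lemma posdef_gram:
  assumes "\<And>v l. (\<And>i. i < r \<Longrightarrow> (\<Sum>l<m. B i l * v l) = 0) \<Longrightarrow> l < m \<Longrightarrow> v l = 0"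
  shows "posdef m (gram r B)"
proof (rule posdefI)
  fix v :: "nat \<Rightarrow> real" and l
  assume "l < m" "v l \<noteq> 0"
  then obtain i where "i < r" "(\<Sum>l<m. B i l * v l) \<noteq> 0"
    using assms by blast
  then show "0 < (\<Sum>i<m. \<Sum>j<m. v i * gram r B i j * v j)"
    unfolding gram_quadratic by (intro sum_pos2[of _ i]) auto
qed (rule gram_sym)

text \<open>The residual of a solution of the normal equations is orthogonal to the range of \<open>B\<close>, and any
  other residual differs from it by an element of this range.\<close>

lemma normal_eq_pythagoras:
  assumes "normal_eq r m B c g"
  shows "(\<Sum>i<r. (residual m B c g' i)\<^sup>2) =
    (\<Sum>i<r. (residual m B c g i)\<^sup>2) + (\<Sum>i<r. (\<Sum>l<m. B i l * (g' l - g l))\<^sup>2)"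
proof -
  define u where "u i = (\<Sum>l<m. B i l * (g' l - g l))" for i
  have "(\<Sum>i<r. u i * residual m B c g i) = (\<Sum>l<m. (g' l - g l) * (\<Sum>i<r. B i l * residual m B c g i))"
    unfolding u_def sum_distrib_left sum_distrib_right
    by (subst sum.swap) (simp add: mult_ac)
  then have orth: "(\<Sum>i<r. u i * residual m B c g i) = 0"
    using assms by (simp add: normal_eq_iff)
  have shift: "residual m B c g' i = residual m B c g i - u i" for i
    by (simp add: residual_def u_def algebra_simps sum_subtractf)
  have "(\<Sum>i<r. (residual m B c g' i)\<^sup>2) =
      (\<Sum>i<r. (residual m B c g i)\<^sup>2 + (u i)\<^sup>2 - 2 * (u i * residual m B c g i))"
    unfolding shift by (simp add: power2_eq_square algebra_simps)
  also have "\<dots> = (\<Sum>i<r. (residual m B c g i)\<^sup>2) + (\<Sum>i<r. (u i)\<^sup>2) - 2 * (\<Sum>i<r. u i * residual m B c g i)"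
    by (simp add: sum.distrib sum_subtractf sum_distrib_left)
  finally show ?thesis
    using orth by (simp add: u_def)
qed

lemma tendsto_linear_family:
  fixes dB :: "nat \<Rightarrow> nat \<Rightarrow> nat \<Rightarrow> real"
  shows "((\<lambda>x. \<Sum>t<dim_vec h. x $ t * dB t i j) \<longlongrightarrow> (\<Sum>t<dim_vec h. h $ t * dB t i j)) (vec_nhds h)"
  by (intro tendsto_intros tendsto_coord) simp

lemma posdef_gram_eventually:
  fixes dB :: "nat \<Rightarrow> nat \<Rightarrow> nat \<Rightarrow> real"
  assumes "posdef m (gram r (\<lambda>i j. \<Sum>t<dim_vec h. h $ t * dB t i j))"
  shows "\<forall>\<^sub>F x in vec_nhds h. posdef m (gram r (\<lambda>i j. \<Sum>t<dim_vec h. x $ t * dB t i j))"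
proof (rule posdef_eventually[OF assms])
  show "((\<lambda>x. gram r (\<lambda>i j. \<Sum>t<dim_vec h. x $ t * dB t i j) i j) \<longlongrightarrow>
      gram r (\<lambda>i j. \<Sum>t<dim_vec h. h $ t * dB t i j) i j) (vec_nhds h)" for i j
    unfolding gram_def by (intro tendsto_sum tendsto_mult tendsto_linear_family)
qed (auto simp: gram_sym)

text \<open>The derivative of the optimal residual \<open>e(x) = c - B(x) g(x)\<close> for a matrix \<open>B(x) = \<Sum>\<^sub>t x\<^sub>t dB\<^sub>t\<close>.
  Subtracting \<open>B(x)\<^sup>T B(x) g(h)\<close> from the normal equations at \<open>x\<close> and using those at \<open>h\<close> gives the
  exact identity
  \<open>B(x)\<^sup>T B(x) (g(x) - g(h)) = \<Sum>\<^sub>t (x\<^sub>t - h\<^sub>t) (dB\<^sub>t\<^sup>T e(h) - B(x)\<^sup>T dB\<^sub>t g(h))\<close>.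
  Therefore the solutions \<open>q\<^sub>t(x)\<close> of the systems with matrix \<open>B(x)\<^sup>T B(x)\<close> and the vectors on the
  right as right-hand sides are slopes of \<open>g\<close>, and they converge to the solutions \<open>X\<^sub>t\<close> of the
  systems at \<open>h\<close>. No derivative of an inverse matrix has to be computed.\<close>

lemma projected_residual_slopes:
  fixes dB :: "nat \<Rightarrow> nat \<Rightarrow> nat \<Rightarrow> real" and g :: "real vec \<Rightarrow> nat \<Rightarrow> real" and h :: "real vec"
  defines "B \<equiv> \<lambda>x i j. \<Sum>t<dim_vec h. x $ t * dB t i j"
  assumes pd: "posdef m (gram r (B h))"
    and g: "\<forall>\<^sub>F x in vec_nhds h. normal_eq r m (B x) c (g x)"
    and X: "\<And>t. t < dim_vec h \<Longrightarrow> solves m (gram r (B h)) (X t)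
      (\<lambda>j. \<Sum>i<r. dB t i j * residual m (B h) c (g h) i - B h i j * (\<Sum>l<m. dB t i l * g h l))"
  shows "has_slopes (\<lambda>x. residual m (B x) c (g x) i)
    (\<lambda>t. - (\<Sum>l<m. dB t i l * g h l) - (\<Sum>l<m. B h i l * X t l)) h"
proof -
  let ?n = "dim_vec h"
  define e where "e = residual m (B h) c (g h)"
  define u where "u t i = (\<Sum>l<m. dB t i l * g h l)" for t i
  define y where "y t x j = (\<Sum>i<r. dB t i j * e i - B x i j * u t i)" for t x j
  define q where "q t x = (SOME z. solves m (gram r (B x)) z (y t x))" for t x
  have Btend: "((\<lambda>x. B x i j) \<longlongrightarrow> B h i j) (vec_nhds h)" for i j
    unfolding B_def by (rule tendsto_linear_family)
  then have gramtend: "((\<lambda>x. gram r (B x) i j) \<longlongrightarrow> gram r (B h) i j) (vec_nhds h)" for i j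
    unfolding gram_def by (intro tendsto_intros)
  have pd_ev: "\<forall>\<^sub>F x in vec_nhds h. posdef m (gram r (B x))"
    using pd unfolding B_def by (rule posdef_gram_eventually)
  then have q: "\<forall>\<^sub>F x in vec_nhds h. solves m (gram r (B x)) (q t x) (y t x)" for t
    unfolding q_def by eventually_elim (rule someI_ex[OF posdef_solution_exists])
  have qtend: "((\<lambda>x. q t x l) \<longlongrightarrow> X t l) (vec_nhds h)" if "t < ?n" "l < m" for t l
  proof (rule solution_tendsto[OF pd gramtend _ q _ that(2)])
    show "((\<lambda>x. y t x j) \<longlongrightarrow> y t h j) (vec_nhds h)" for j
      unfolding y_def by (intro tendsto_intros Btend)
    show "solves m (gram r (B h)) (X t) (y t h)"
      using X[OF that(1)] unfolding y_def e_def u_def .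
  qed
  have orth: "(\<Sum>i<r. B h i j * e i) = 0" if "j < m" for j
    using eventually_vec_nhds_self[OF g] that unfolding normal_eq_iff e_def by blast
  have dB: "B x i j - B h i j = (\<Sum>t<?n. dB t i j * (x $ t - h $ t))" for x i j
    by (simp add: B_def sum_subtractf[symmetric] algebra_simps)
  have du: "(\<Sum>l<m. (B x i l - B h i l) * g h l) = (\<Sum>t<?n. u t i * (x $ t - h $ t))" for x i
    unfolding dB u_def sum_distrib_right by (subst sum.swap) (simp add: mult_ac)
  have "\<forall>\<^sub>F x in vec_nhds h. \<forall>l<m. g x l - g h l = (\<Sum>t<?n. q t x l * (x $ t - h $ t))"
  proof -
    have "\<forall>\<^sub>F x in vec_nhds h. \<forall>t\<in>{..<?n}. solves m (gram r (B x)) (q t x) (y t x)"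
      using q by (simp add: eventually_ball_finite)
    with pd_ev g show ?thesis
    proof eventually_elim
      case (elim x)
      define b where "b j = (\<Sum>t<?n. y t x j * (x $ t - h $ t))" for j
      have "solves m (gram r (B x)) (\<lambda>l. g x l - g h l) b"
        unfolding solves_def
      proof (intro allI impI)
        fix j
        assume j: "j < m"
        have "(\<Sum>l<m. gram r (B x) j l * (g x l - g h l)) =
            (\<Sum>i<r. B x i j * c i) - (\<Sum>i<r. B x i j * (\<Sum>l<m. B x i l * g h l))"
          using elim(2) j unfolding gram_mult[symmetric]
          by (simp add: normal_eq_def solves_def right_diff_distrib sum_subtractf)
        also have "\<dots> = (\<Sum>i<r. B x i j * (c i - (\<Sum>l<m. B x i l * g h l)))"
          by (simp add: right_diff_distrib sum_subtractf)
        also have "\<dots> = (\<Sum>i<r. B x i j * (e i - (\<Sum>l<m. (B x i l - B h i l) * g h l)))"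
          by (simp add: e_def residual_def left_diff_distrib sum_subtractf)
        also have "\<dots> = (\<Sum>i<r. (B x i j - B h i j) * e i) - (\<Sum>i<r. B x i j * (\<Sum>t<?n. u t i * (x $ t - h $ t)))"
          using orth[OF j] unfolding du by (simp add: left_diff_distrib right_diff_distrib sum_subtractf)
        also have "\<dots> = (\<Sum>i<r. \<Sum>t<?n. (dB t i j * e i - B x i j * u t i) * (x $ t - h $ t))"
          unfolding dB sum_distrib_left sum_distrib_right sum_subtractf[symmetric]
          by (intro sum.cong refl) (simp add: algebra_simps)
        also have "\<dots> = b j"
          unfolding b_def y_def sum_distrib_right by (rule sum.swap)
        finally show "(\<Sum>l<m. gram r (B x) j l * (g x l - g h l)) = b j" .
      qed
      moreover have "solves m (gram r (B x)) (\<lambda>l. \<Sum>t<?n. q t x l * (x $ t - h $ t)) b"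
        unfolding solves_def
      proof (intro allI impI)
        fix j
        assume j: "j < m"
        have "(\<Sum>l<m. gram r (B x) j l * (\<Sum>t<?n. q t x l * (x $ t - h $ t))) =
            (\<Sum>t<?n. (\<Sum>l<m. gram r (B x) j l * q t x l) * (x $ t - h $ t))"
          unfolding sum_distrib_left sum_distrib_right by (subst sum.swap) (simp add: mult_ac)
        also have "\<dots> = b j"
          using elim(3) j by (simp add: solves_def b_def)
        finally show "(\<Sum>l<m. gram r (B x) j l * (\<Sum>t<?n. q t x l * (x $ t - h $ t))) = b j" .
      qed
      ultimately show ?case
        using posdef_solution_unique[OF elim(1)] by blast
    qed
  qed
  then have "\<forall>\<^sub>F x in vec_nhds h. residual m (B x) c (g x) i - residual m (B h) c (g h) i =
      (\<Sum>t<?n. (- u t i - (\<Sum>l<m. B x i l * q t x l)) * (x $ t - h $ t))"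
  proof eventually_elim
    case (elim x)
    have "residual m (B x) c (g x) i - residual m (B h) c (g h) i =
        - (\<Sum>l<m. (B x i l - B h i l) * g h l) - (\<Sum>l<m. B x i l * (g x l - g h l))"
      by (simp add: residual_def algebra_simps sum_subtractf)
    also have "(\<Sum>l<m. B x i l * (g x l - g h l)) =
        (\<Sum>l<m. B x i l * (\<Sum>t<?n. q t x l * (x $ t - h $ t)))"
      using elim by simp
    also have "\<dots> = (\<Sum>t<?n. (\<Sum>l<m. B x i l * q t x l) * (x $ t - h $ t))"
      unfolding sum_distrib_left sum_distrib_right by (subst sum.swap) (simp add: mult_ac)
    finally show ?case
      unfolding du by (simp add: left_diff_distrib sum_subtractf sum_negf)
  qed
  moreover have "((\<lambda>x. - u t i - (\<Sum>l<m. B x i l * q t x l)) \<longlongrightarrow>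
      - (\<Sum>l<m. dB t i l * g h l) - (\<Sum>l<m. B h i l * X t l)) (vec_nhds h)" if "t < ?n" for t
    unfolding u_def by (intro tendsto_intros Btend qtend that) simp
  ultimately show ?thesis
    unfolding has_slopes_def by (intro exI[of _ "\<lambda>t x. - u t i - (\<Sum>l<m. B x i l * q t x l)"]) blast
qed

section \<open>Deriving values with straight-line programs\<close>

lemma run_append: "run xs (p @ q) rs = Option.bind (run xs p rs) (run xs q)"
  by (induction p arbitrary: rs) (auto split: bind_splits)

lemma run_length: "run xs p rs = Some rs' \<Longrightarrow> length rs' = length rs + length p"
  by (induction p arbitrary: rs) (auto split: bind_splits)

lemma fetch_append: "fetch xs rs a = Some v \<Longrightarrow> fetch xs (rs @ us) a = Some v"
  by (cases a) (auto split: if_splits simp: nth_append)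

locale straight_line =
  fixes D :: "'a set" and inp :: "'a \<Rightarrow> real list"
begin

text \<open>The value functions in \<open>F\<close> (quantities that depend on the problem data \<open>\<theta>\<close>) can all be read off
  after one program of at most \<open>c\<close> flops. Program and operands are chosen before \<open>\<theta>\<close>, so the
  same instructions serve all data in \<open>D\<close>.\<close>

definition tabulates :: "nat \<Rightarrow> ('a \<Rightarrow> real) set \<Rightarrow> bool" where
  "tabulates c F \<longleftrightarrow> (\<exists>p rs. length p \<le> c \<and> (\<forall>\<theta>\<in>D. run (inp \<theta>) p [] = Some (rs \<theta>)) \<and>
     (\<forall>f\<in>F. \<exists>a. \<forall>\<theta>\<in>D. fetch (inp \<theta>) (rs \<theta>) a = Some (f \<theta>)))"

text \<open>A program that already provides \<open>F\<close> extends by \<open>a\<close> flops to one that also provides \<open>G\<close>. The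
  quantification over all larger sets \<open>F'\<close> makes costs add up under composition while every
  value that was once computed remains available.\<close>

definition derives :: "('a \<Rightarrow> real) set \<Rightarrow> nat \<Rightarrow> ('a \<Rightarrow> real) set \<Rightarrow> bool" where
  "derives F a G \<longleftrightarrow> (\<forall>c F'. F \<subseteq> F' \<longrightarrow> tabulates c F' \<longrightarrow> tabulates (c + a) (F' \<union> G))"

lemma tabulates_mono: "tabulates c F \<Longrightarrow> c \<le> c' \<Longrightarrow> G \<subseteq> F \<Longrightarrow> tabulates c' G"
  unfolding tabulates_def by (meson order_trans subsetD)

lemma derivesD: "derives F a G \<Longrightarrow> F \<subseteq> F' \<Longrightarrow> tabulates c F' \<Longrightarrow> tabulates (c + a) (F' \<union> G)"
  unfolding derives_def by blast

lemma derives_computes: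
  assumes "derives {} a (set fs)"
  shows "\<exists>prog outs. length prog \<le> a \<and>
    (\<forall>\<theta>\<in>D. computes prog outs (inp \<theta>) (map (\<lambda>f. f \<theta>) fs))"
proof -
  have "tabulates 0 {}"
    unfolding tabulates_def by (intro exI[of _ "[]"]) auto
  from derivesD[OF assms subset_refl this] obtain p rs where p: "length p \<le> a"
      and run: "\<forall>\<theta>\<in>D. run (inp \<theta>) p [] = Some (rs \<theta>)"
      and "\<forall>f\<in>set fs. \<exists>a. \<forall>\<theta>\<in>D. fetch (inp \<theta>) (rs \<theta>) a = Some (f \<theta>)"
    unfolding tabulates_def by auto
  then obtain op where op: "\<And>f \<theta>. f \<in> set fs \<Longrightarrow> \<theta> \<in> D \<Longrightarrow> fetch (inp \<theta>) (rs \<theta>) (op f) = Some (f \<theta>)"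
    by metis
  have "computes p (map op fs) (inp \<theta>) (map (\<lambda>f. f \<theta>) fs)" if "\<theta> \<in> D" for \<theta>
    unfolding computes_def using run op that by auto
  with p show ?thesis by blast
qed

lemma derives_weaken:
  assumes "derives F a G" "F \<subseteq> F'" "a \<le> b" "G' \<subseteq> G"
  shows "derives F' b G'"
  unfolding derives_def
proof (intro allI impI)
  fix c F''
  assume "F' \<subseteq> F''" "tabulates c F''"
  then have "tabulates (c + a) (F'' \<union> G)"
    using assms(1,2) derivesD by blast
  then show "tabulates (c + b) (F'' \<union> G')"
    by (rule tabulates_mono) (use assms in auto)
qed

lemma derives_cut:
  assumes "derives F a G" "derives (F \<union> G) b H"
  shows "derives F (a + b) (G \<union> H)"
  unfolding derives_def
proof (intro allI impI)
  fix c F'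
  assume F': "F \<subseteq> F'" "tabulates c F'"
  then have "tabulates (c + a) (F' \<union> G)"
    using assms(1) derivesD by blast
  then have "tabulates (c + a + b) (F' \<union> G \<union> H)"
    using assms(2) derivesD F'(1) by (metis Un_mono subset_refl)
  then show "tabulates (c + (a + b)) (F' \<union> (G \<union> H))"
    by (simp add: Un_assoc add.assoc)
qed

lemma derives_then:
  assumes "derives F a G" "derives (F \<union> G) b H"
  shows "derives F (a + b) H"
  using derives_weaken[OF derives_cut[OF assms], of F "a + b" H] by blast

lemma derives_Un:
  assumes "derives F a G" "derives F b H"
  shows "derives F (a + b) (G \<union> H)"
  using derives_cut[OF assms(1)] derives_weaken[OF assms(2)] by blast

lemma derives_empty: "derives F 0 {}"
  unfolding derives_def by simp

lemma derives_UN_sum: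
  assumes "finite K" "\<And>k. k \<in> K \<Longrightarrow> derives F (a k) (G k)"
  shows "derives F (\<Sum>k\<in>K. a k) (\<Union>k\<in>K. G k)"
  using assms
proof (induction K rule: finite_induct)
  case empty
  then show ?case by (simp add: derives_empty)
next
  case (insert k K)
  then show ?case
    using derives_Un[of F "a k" "G k" "\<Sum>k\<in>K. a k" "\<Union>k\<in>K. G k"] by simp
qed

lemma derives_image:
  assumes "finite K" "\<And>k. k \<in> K \<Longrightarrow> derives F a {f k}" "card K * a \<le> b"
  shows "derives F b (f ` K)"
proof -
  have "derives F (card K * a) (\<Union>k\<in>K. {f k})"
    using derives_UN_sum[OF assms(1), of F "\<lambda>_. a" "\<lambda>k. {f k}"] assms(2) by simp
  then show ?thesis
    by (rule derives_weaken) (use assms in auto)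
qed

text \<open>Only the values on \<open>D\<close> matter. In particular, an entry that vanishes for all data is a constant
  and costs nothing; this is how sparsity saves flops.\<close>

lemma derives_cong:
  assumes "derives F a {f}" "\<And>\<theta>. \<theta> \<in> D \<Longrightarrow> g \<theta> = f \<theta>"
  shows "derives F a {g}"
  unfolding derives_def
proof (intro allI impI)
  fix c F'
  assume "F \<subseteq> F'" "tabulates c F'"
  then have "tabulates (c + a) (F' \<union> {f})"
    using assms(1) derivesD by blast
  then show "tabulates (c + a) (F' \<union> {g})"
    using assms(2) unfolding tabulates_def by fastforce
qed

lemma derives_member: "f \<in> F \<Longrightarrow> derives F 0 {f}"
  unfolding derives_def by (auto simp: insert_absorb subset_iff)

lemma derives_operand:
  assumes "\<And>\<theta> rs. \<theta> \<in> D \<Longrightarrow> fetch (inp \<theta>) rs a = Some (f \<theta>)"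
  shows "derives F 0 {f}"
  using assms unfolding derives_def tabulates_def by (metis UnE add.right_neutral singletonD)

lemma derives_const: "derives F 0 {\<lambda>_. of_int c}"
  by (rule derives_operand[of "Const c"]) simp

lemma derives_zero: "derives F 0 {\<lambda>_. 0}"
  using derives_const[of F 0] by simp

lemma derives_input:
  assumes "\<And>\<theta>. \<theta> \<in> D \<Longrightarrow> inp \<theta> = map (\<lambda>f. f \<theta>) fs" "f \<in> set fs"
  shows "derives F 0 {f}"
proof -
  from assms(2) obtain i where "i < length fs" "fs ! i = f"
    by (auto simp: in_set_conv_nth)
  then show ?thesis
    by (intro derives_operand[of "Input i"]) (simp add: assms(1))
qed

text \<open>The single place where an instruction is appended. The new value lands in the register whose
  number is the length of the old program, and this number does not depend on the data.\<close>

lemma derives_flop: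
  assumes exec: "\<And>a b \<theta> rs. \<theta> \<in> D \<Longrightarrow> fetch (inp \<theta>) rs a = Some (f \<theta>) \<Longrightarrow>
      fetch (inp \<theta>) rs b = Some (g \<theta>) \<Longrightarrow> exec_flop (inp \<theta>) rs (instr a b) = Some (h \<theta>)"
    and f: "derives F m {f}" and g: "derives F n {g}"
  shows "derives F (m + n + 1) {h}"
proof -
  have "derives {f, g} 1 {h}"
    unfolding derives_def
  proof (intro allI impI)
    fix c F'
    assume sub: "{f, g} \<subseteq> F'" and "tabulates c F'"
    then obtain p rs where p: "length p \<le> c"
        and run: "\<forall>\<theta>\<in>D. run (inp \<theta>) p [] = Some (rs \<theta>)"
        and "\<forall>f\<in>F'. \<exists>a. \<forall>\<theta>\<in>D. fetch (inp \<theta>) (rs \<theta>) a = Some (f \<theta>)"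
      unfolding tabulates_def by blast
    then obtain op where
        op: "\<And>f \<theta>. f \<in> F' \<Longrightarrow> \<theta> \<in> D \<Longrightarrow> fetch (inp \<theta>) (rs \<theta>) (op f) = Some (f \<theta>)"
      by metis
    let ?i = "instr (op f) (op g)"
    have new: "exec_flop (inp \<theta>) (rs \<theta>) ?i = Some (h \<theta>)" if "\<theta> \<in> D" for \<theta>
      using exec[OF that] op that sub by simp
    have reg: "fetch (inp \<theta>) (rs \<theta> @ [h \<theta>]) (Reg (length p)) = Some (h \<theta>)" if "\<theta> \<in> D" for \<theta>
      using run_length[of "inp \<theta>" p "[]" "rs \<theta>"] run that by (simp add: nth_append)
    show "tabulates (c + 1) (F' \<union> {h})"
      unfolding tabulates_def
    proof (rule exI[of _ "p @ [?i]"], rule exI[of _ "\<lambda>\<theta>. rs \<theta> @ [h \<theta>]"], intro conjI ballI)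
      show "length (p @ [?i]) \<le> c + 1" using p by simp
      show "run (inp \<theta>) (p @ [?i]) [] = Some (rs \<theta> @ [h \<theta>])" if "\<theta> \<in> D" for \<theta>
        using that run new by (simp add: run_append)
      fix k assume "k \<in> F' \<union> {h}"
      then show "\<exists>a. \<forall>\<theta>\<in>D. fetch (inp \<theta>) (rs \<theta> @ [h \<theta>]) a = Some (k \<theta>)"
        using op fetch_append reg by (metis UnE singletonD)
    qed
  qed
  then have "derives (F \<union> {f, g}) 1 {h}"
    by (rule derives_weaken) auto
  moreover have "derives F (m + n) {f, g}"
    using derives_Un[OF f g] by (simp add: insert_commute)
  ultimately show ?thesis
    using derives_then by blast
qed

lemma derives_add:
  "derives F m {f} \<Longrightarrow> derives F n {g} \<Longrightarrow> derives F (m + n + 1) {\<lambda>\<theta>. f \<theta> + g \<theta>}"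
  by (rule derives_flop[where instr = Add]) (auto simp: binary_def)

lemma derives_diff:
  "derives F m {f} \<Longrightarrow> derives F n {g} \<Longrightarrow> derives F (m + n + 1) {\<lambda>\<theta>. f \<theta> - g \<theta>}"
  by (rule derives_flop[where instr = Sub]) (auto simp: binary_def)

lemma derives_mult:
  "derives F m {f} \<Longrightarrow> derives F n {g} \<Longrightarrow> derives F (m + n + 1) {\<lambda>\<theta>. f \<theta> * g \<theta>}"
  by (rule derives_flop[where instr = Mul]) (auto simp: binary_def)

lemma derives_divide:
  assumes "derives F m {f}" "derives F n {g}" "\<And>\<theta>. \<theta> \<in> D \<Longrightarrow> g \<theta> \<noteq> 0"
  shows "derives F (m + n + 1) {\<lambda>\<theta>. f \<theta> / g \<theta>}"
  using assms by (intro derives_flop[where instr = Div and f = f and g = g]) (auto simp: binary_def)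

lemma derives_sqrt:
  assumes "derives F m {f}" "\<And>\<theta>. \<theta> \<in> D \<Longrightarrow> 0 \<le> f \<theta>"
  shows "derives F (m + 1) {\<lambda>\<theta>. sqrt (f \<theta>)}"
  using derives_flop[where instr = "\<lambda>a _. Sqrt a" and f = f and g = "\<lambda>_. 0", OF _ assms(1) derives_zero]
    assms(2) by (force simp: not_less[symmetric])

lemma derives_sum:
  assumes "finite K" "\<And>k. k \<in> K \<Longrightarrow> derives F a {f k}" "card K * (a + 1) \<le> b"
  shows "derives F b {\<lambda>\<theta>. \<Sum>k\<in>K. f k \<theta>}"
proof -
  have "derives F (card K * (a + 1)) {\<lambda>\<theta>. \<Sum>k\<in>K. f k \<theta>}"
    using assms(1,2)
  proof (induction K rule: finite_induct)
    case empty
    then show ?case by (simp add: derives_zero)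
  next
    case (insert k K)
    then show ?case
      using derives_add[of F a "f k" "card K * (a + 1)" "\<lambda>\<theta>. \<Sum>k\<in>K. f k \<theta>"]
      by (simp add: algebra_simps)
  qed
  then show ?thesis
    by (rule derives_weaken) (use assms in auto)
qed

end

section \<open>Banded positive definite systems\<close>

context straight_line
begin

text \<open>Elimination without pivoting for a matrix of bandwidth \<open>d\<close> and \<open>q\<close> right-hand sides. In one step,
  only the leading \<open>d \<times> d\<close> corner of the Schur complement and the first \<open>d\<close> entries of each
  right-hand side change, because the pivot row and column have at most \<open>d\<close> further nonzero
  entries; updating an entry takes three flops. The first unknown is recovered from the later
  ones with \<open>2 d + 2\<close> flops. The unknowns \<open>X\<close> are given by the equations that they satisfy, so
  that no formula for them is needed.\<close>

lemma banded_solve: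
  assumes A: "\<And>i j. i < m \<Longrightarrow> j < m \<Longrightarrow> derives F 0 {A i j}"
    and R: "\<And>i c. i < m \<Longrightarrow> c < q \<Longrightarrow> derives F 0 {R i c}"
    and pd: "\<And>\<theta>. \<theta> \<in> D \<Longrightarrow> posdef m (\<lambda>i j. A i j \<theta>)"
    and band: "\<And>i j \<theta>. \<theta> \<in> D \<Longrightarrow> i < m \<Longrightarrow> j < m \<Longrightarrow> i + d < j \<or> j + d < i \<Longrightarrow> A i j \<theta> = 0"
    and sol: "\<And>c \<theta>. \<theta> \<in> D \<Longrightarrow> c < q \<Longrightarrow>
      solves m (\<lambda>i j. A i j \<theta>) (\<lambda>i. X i c \<theta>) (\<lambda>i. R i c \<theta>)"
  shows "derives F (m * (3 * d\<^sup>2 + (5 * d + 2) * q)) ((\<lambda>(i, c). X i c) ` ({..<m} \<times> {..<q}))"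
  using assms
proof (induction m arbitrary: F A R X)
  case 0
  then show ?case by (simp add: derives_empty)
next
  case (Suc m)
  let ?s = "min d m"
  define A' where "A' i j \<theta> = A (Suc i) (Suc j) \<theta> - A (Suc i) 0 \<theta> * A 0 (Suc j) \<theta> / A 0 0 \<theta>"
    for i j \<theta>
  define R' where "R' i c \<theta> = R (Suc i) c \<theta> - A (Suc i) 0 \<theta> * R 0 c \<theta> / A 0 0 \<theta>" for i c \<theta>
  have A': "(\<lambda>i j. A' i j \<theta>) = schur (\<lambda>i j. A i j \<theta>)" for \<theta>
    by (simp add: A'_def schur_def fun_eq_iff)
  have R': "(\<lambda>i. R' i c \<theta>) = reduced_rhs (\<lambda>i j. A i j \<theta>) (\<lambda>i. R i c \<theta>)" for c \<theta>
    by (simp add: R'_def reduced_rhs_def fun_eq_iff)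
  have pivot: "A 0 0 \<theta> \<noteq> 0" and pd': "posdef m (\<lambda>i j. A' i j \<theta>)" if "\<theta> \<in> D" for \<theta>
    using posdef_SucD[OF Suc.prems(3)[OF that]] unfolding A' by auto
  have sol0: "X 0 c \<theta> = (R 0 c \<theta> - (\<Sum>j<m. A 0 (Suc j) \<theta> * X (Suc j) c \<theta>)) / A 0 0 \<theta>"
    and sol': "solves m (\<lambda>i j. A' i j \<theta>) (\<lambda>i. X (Suc i) c \<theta>) (\<lambda>i. R' i c \<theta>)"
    if "\<theta> \<in> D" "c < q" for c \<theta>
    using Suc.prems(5)[OF that] solves_Suc_iff[of "\<lambda>i j. A i j \<theta>" m "\<lambda>i. X i c \<theta>" "\<lambda>i. R i c \<theta>"]
      pivot[OF that(1)] unfolding A' R' by auto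
  define GA where "GA = (\<lambda>(i, j). A' i j) ` ({..<?s} \<times> {..<?s})"
  define GR where "GR = (\<lambda>(i, c). R' i c) ` ({..<?s} \<times> {..<q})"
  define GX where "GX = (\<lambda>(i, c). X (Suc i) c) ` ({..<m} \<times> {..<q})"
  have "derives F (3 * d\<^sup>2) GA"
    unfolding GA_def
  proof (rule derives_image[where a = 3])
    fix ij
    assume "ij \<in> {..<?s} \<times> {..<?s}"
    then obtain i j where ij: "ij = (i, j)" "i < m" "j < m" by auto
    have "derives F (0 + (0 + 0 + 1 + 0 + 1) + 1) {A' i j}"
      unfolding A'_def using ij
      by (intro derives_diff derives_divide derives_mult Suc.prems(1) pivot) auto
    then show "derives F 3 {case ij of (i, j) \<Rightarrow> A' i j}"
      unfolding ij(1) by (simp add: numeral_3_eq_3)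
  next
    have "?s * ?s \<le> d * d" by (intro mult_mono) auto
    then show "card ({..<?s} \<times> {..<?s}) * 3 \<le> 3 * d\<^sup>2"
      by (simp add: power2_eq_square)
  qed simp
  moreover have "derives F (3 * d * q) GR"
    unfolding GR_def
  proof (rule derives_image[where a = 3])
    fix ij
    assume "ij \<in> {..<?s} \<times> {..<q}"
    then obtain i c where ij: "ij = (i, c)" "i < m" "c < q" by auto
    have "derives F (0 + (0 + 0 + 1 + 0 + 1) + 1) {R' i c}"
      unfolding R'_def using ij
      by (intro derives_diff derives_divide derives_mult Suc.prems(1,2) pivot) auto
    then show "derives F 3 {case ij of (i, j) \<Rightarrow> R' i j}"
      unfolding ij(1) by (simp add: numeral_3_eq_3)
  qed auto
  ultimately have step: "derives F (3 * d\<^sup>2 + 3 * d * q) (GA \<union> GR)"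
    by (rule derives_Un)
  let ?F = "F \<union> (GA \<union> GR)"
  have lift: "derives ?F 0 {f}" if "derives F 0 {f}" for f
    using derives_weaken[OF that, of ?F 0 "{f}"] by blast
  have "derives ?F (m * (3 * d\<^sup>2 + (5 * d + 2) * q)) GX"
    unfolding GX_def
  proof (rule Suc.IH[where A = A' and R = R'])
    show "derives ?F 0 {A' i j}" if "i < m" "j < m" for i j
    proof (cases "i < d \<and> j < d")
      case True
      with that have "A' i j \<in> ?F" by (auto simp: GA_def)
      then show ?thesis by (rule derives_member)
    next
      case False
      have "A' i j \<theta> = A (Suc i) (Suc j) \<theta>" if "\<theta> \<in> D" for \<theta>
      proof -
        have "A (Suc i) 0 \<theta> = 0 \<or> A 0 (Suc j) \<theta> = 0"
          using False Suc.prems(4)[OF \<open>\<theta> \<in> D\<close>] \<open>i < m\<close> \<open>j < m\<close> by auto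
        then show ?thesis by (auto simp: A'_def)
      qed
      then show ?thesis
        using lift[OF Suc.prems(1)[of "Suc i" "Suc j"]] that by (auto intro: derives_cong)
    qed
    show "derives ?F 0 {R' i c}" if "i < m" "c < q" for i c
    proof (cases "i < d")
      case True
      with that have "R' i c \<in> ?F" by (auto simp: GR_def)
      then show ?thesis by (rule derives_member)
    next
      case False
      have "R' i c \<theta> = R (Suc i) c \<theta>" if "\<theta> \<in> D" for \<theta>
        using False Suc.prems(4)[OF \<open>\<theta> \<in> D\<close>, of "Suc i" 0] \<open>i < m\<close> by (simp add: R'_def)
      then show ?thesis
        using lift[OF Suc.prems(2)[of "Suc i" c]] that by (auto intro: derives_cong)
    qed
    show "A' i j \<theta> = 0" if "\<theta> \<in> D" "i < m" "j < m" "i + d < j \<or> j + d < i" for i j \<theta>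
    proof -
      have "A (Suc i) (Suc j) \<theta> = 0" and "A (Suc i) 0 \<theta> = 0 \<or> A 0 (Suc j) \<theta> = 0"
        using that Suc.prems(4)[OF that(1)] by auto
      then show ?thesis by (auto simp: A'_def)
    qed
  qed (use pd' sol' in auto)
  with step have tail: "derives F (3 * d\<^sup>2 + 3 * d * q + m * (3 * d\<^sup>2 + (5 * d + 2) * q)) GX"
    by (rule derives_then)
  have "derives (F \<union> GX) ((2 * d + 2) * q) ((\<lambda>c. X 0 c) ` {..<q})"
  proof (rule derives_image[where a = "2 * d + 2"])
    fix c
    assume c: "c \<in> {..<q}"
    have lift: "derives (F \<union> GX) 0 {f}" if "derives F 0 {f}" for f
      using derives_weaken[OF that, of "F \<union> GX" 0 "{f}"] by blast
    let ?S = "\<lambda>\<theta>. \<Sum>j<?s. A 0 (Suc j) \<theta> * X (Suc j) c \<theta>"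
    have "derives (F \<union> GX) (2 * d) {?S}"
    proof (rule derives_sum[where a = 1])
      fix j
      assume "j \<in> {..<?s}"
      then have "j < m" by simp
      with c have "X (Suc j) c \<in> F \<union> GX" by (auto simp: GX_def)
      then have "derives (F \<union> GX) (0 + 0 + 1) {\<lambda>\<theta>. A 0 (Suc j) \<theta> * X (Suc j) c \<theta>}"
        using \<open>j < m\<close> by (intro derives_mult derives_member lift Suc.prems(1)) auto
      then show "derives (F \<union> GX) 1 {\<lambda>\<theta>. A 0 (Suc j) \<theta> * X (Suc j) c \<theta>}"
        by simp
    qed auto
    then have "derives (F \<union> GX) (0 + 2 * d + 1 + 0 + 1) {\<lambda>\<theta>. (R 0 c \<theta> - ?S \<theta>) / A 0 0 \<theta>}"
      using c by (intro derives_divide derives_diff lift Suc.prems(1,2) pivot) auto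
    then have "derives (F \<union> GX) (2 * d + 2) {\<lambda>\<theta>. (R 0 c \<theta> - ?S \<theta>) / A 0 0 \<theta>}"
      by simp
    then show "derives (F \<union> GX) (2 * d + 2) {X 0 c}"
    proof (rule derives_cong)
      fix \<theta>
      assume \<theta>: "\<theta> \<in> D"
      have "(\<Sum>j<m. A 0 (Suc j) \<theta> * X (Suc j) c \<theta>) = ?S \<theta>"
        using Suc.prems(4)[OF \<theta>, of 0] by (intro sum.mono_neutral_right) auto
      with \<theta> c sol0 show "X 0 c \<theta> = (R 0 c \<theta> - ?S \<theta>) / A 0 0 \<theta>" by simp
    qed
  qed auto
  from derives_cut[OF tail this] show ?case
  proof (rule derives_weaken)
    have "X i c \<in> GX \<union> (\<lambda>c. X 0 c) ` {..<q}" if "i < Suc m" "c < q" for i c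
      by (cases i) (use that in \<open>auto simp: GX_def\<close>)
    then show "(\<lambda>(i, c). X i c) ` ({..<Suc m} \<times> {..<q}) \<subseteq> GX \<union> (\<lambda>c. X 0 c) ` {..<q}"
      by auto
  qed (auto simp: algebra_simps)
qed

end

section \<open>The least squares problem of one polynomial\<close>

text \<open>Rank is the dimension of the span of the set of columns. Full rank thus first excludes
  repeated columns, and then makes the columns linearly independent.\<close>

lemma full_column_rank_imp_injective:
  assumes "full_column_rank A" "v \<in> carrier_vec (dim_col A)" "A *\<^sub>v v = 0\<^sub>v (dim_row A)"
  shows "v = 0\<^sub>v (dim_col A)"
proof (rule ccontr)
  assume v: "v \<noteq> 0\<^sub>v (dim_col A)"
  interpret vec_space "TYPE(real)" "dim_row A" .
  have A: "A \<in> carrier_mat (dim_row A) (dim_col A)" by simp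
  have rank: "rank A = dim_col A"
    using assms(1) by (simp add: full_column_rank_def)
  obtain S where S: "maximal S (\<lambda>T. T \<subseteq> set (cols A) \<and> lin_indpt T)"
    using maximal_exists_superset[of "set (cols A)" "\<lambda>T. T \<subseteq> set (cols A) \<and> lin_indpt T" "{}"]
      finite_lin_indpt2[of "{}"] by auto
  then have "card S = length (cols A)" "S \<subseteq> set (cols A)"
    using rank_card_indpt[OF A S] rank by (auto simp: maximal_def)
  then have "distinct (cols A)"
    using card_mono[of "set (cols A)" S] card_length[of "cols A"] by (intro card_distinct) auto
  with v show False
    using full_rank_lin_indpt[OF A rank] lin_depI[OF A assms(2) v assms(3)] by blast
qed

text \<open>The matrix \<open>diag(\<surd>w) M(z\<^sup>t)\<close>, that is, the derivative of \<open>block_mat w h\<close> with respect to \<open>h\<^sub>t\<close>.\<close>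

definition shift_mat :: "real vec \<Rightarrow> nat \<Rightarrow> nat \<Rightarrow> nat \<Rightarrow> real" where
  "shift_mat w t i j = (if i = j + t then sqrt (w $ i) else 0)"

definition block_mat :: "real vec \<Rightarrow> real vec \<Rightarrow> nat \<Rightarrow> nat \<Rightarrow> real" where
  "block_mat w h i j = (\<Sum>t<dim_vec h. h $ t * shift_mat w t i j)"

definition block_rhs :: "real vec \<Rightarrow> real vec \<Rightarrow> nat \<Rightarrow> real" where
  "block_rhs w p i = sqrt (w $ i) * p $ i"

lemma block_mat_eq:
  "block_mat w h i j = (if j \<le> i \<and> i - j < dim_vec h then sqrt (w $ i) * h $ (i - j) else 0)"
proof -
  have "block_mat w h i j =
      (\<Sum>t\<in>{..<dim_vec h}. if t = i - j then (if j \<le> i then sqrt (w $ i) * h $ (i - j) else 0) else 0)"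
    unfolding block_mat_def shift_mat_def by (intro sum.cong) auto
  then show ?thesis by simp
qed

lemma mult_mat_vec_index:
  assumes "d \<le> n" "h \<in> carrier_vec (d + 1)" "g \<in> carrier_vec (n - d + 1)" "i < n + 1"
  shows "sqrt (w $ i) * (mult_mat (n - d) h *\<^sub>v g) $ i = (\<Sum>l<n - d + 1. block_mat w h i l * g $ l)"
proof -
  have "(mult_mat (n - d) h *\<^sub>v g) $ i =
      (\<Sum>l<n - d + 1. (if l \<le> i \<and> i - l < d + 1 then h $ (i - l) else 0) * g $ l)"
    using assms by (simp add: mult_mat_def scalar_prod_def atLeast0LessThan del: sum.lessThan_Suc)
  then show ?thesis
    using assms by (simp add: block_mat_eq sum_distrib_left del: sum.lessThan_Suc)
      (intro sum.cong, auto)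
qed

lemma sqrt_diag_mult_vec_index:
  assumes "w \<in> carrier_vec n" "v \<in> carrier_vec n" "i < n"
  shows "(sqrt_diag w *\<^sub>v v) $ i = sqrt (w $ i) * v $ i"
proof -
  have "(sqrt_diag w *\<^sub>v v) $ i = (\<Sum>l<n. (if i = l then sqrt (w $ l) else 0) * v $ l)"
    using assms by (simp add: sqrt_diag_def mat_diag_def scalar_prod_def atLeast0LessThan)
  also have "\<dots> = (\<Sum>l\<in>{..<n}. if l = i then sqrt (w $ i) * v $ i else 0)"
    by (intro sum.cong) auto
  finally show ?thesis
    using assms(3) by simp
qed

lemma weighted_residual_index:
  assumes "d \<le> n" "h \<in> carrier_vec (d + 1)" "g \<in> carrier_vec (n - d + 1)"
    and "p \<in> carrier_vec (n + 1)" "w \<in> carrier_vec (n + 1)" "i < n + 1"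
  shows "(sqrt_diag w *\<^sub>v (p - mult_mat (n - d) h *\<^sub>v g)) $ i =
    residual (n - d + 1) (block_mat w h) (block_rhs w p) (\<lambda>l. g $ l) i"
proof -
  have dims: "dim_vec (mult_mat (n - d) h *\<^sub>v g) = n + 1"
    using assms by (simp add: mult_mat_def)
  then have "(sqrt_diag w *\<^sub>v (p - mult_mat (n - d) h *\<^sub>v g)) $ i =
      sqrt (w $ i) * (p - mult_mat (n - d) h *\<^sub>v g) $ i"
    using assms by (intro sqrt_diag_mult_vec_index) (auto intro: carrier_vecI)
  then show ?thesis
    using assms dims mult_mat_vec_index[OF assms(1,2,3,6), of w]
    by (simp add: residual_def block_rhs_def right_diff_distrib)
qed

lemma weighted_norm_sq_residual:
  assumes "d \<le> n" "h \<in> carrier_vec (d + 1)" "g \<in> carrier_vec (n - d + 1)"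
    and "p \<in> carrier_vec (n + 1)" "\<forall>j<n + 1. 0 \<le> w $ j"
  shows "weighted_norm_sq w (mult_mat (n - d) h *\<^sub>v g - p) =
    (\<Sum>i<n + 1. (residual (n - d + 1) (block_mat w h) (block_rhs w p) (\<lambda>l. g $ l) i)\<^sup>2)"
proof -
  have dims: "dim_vec (mult_mat (n - d) h *\<^sub>v g) = n + 1"
    using assms by (simp add: mult_mat_def)
  have "w $ i * ((mult_mat (n - d) h *\<^sub>v g - p) $ i)\<^sup>2 =
      (residual (n - d + 1) (block_mat w h) (block_rhs w p) (\<lambda>l. g $ l) i)\<^sup>2" if i: "i < n + 1" for i
  proof -
    have "residual (n - d + 1) (block_mat w h) (block_rhs w p) (\<lambda>l. g $ l) i =
        sqrt (w $ i) * (p $ i - (mult_mat (n - d) h *\<^sub>v g) $ i)"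
      unfolding residual_def block_rhs_def mult_mat_vec_index[OF assms(1-3) i, symmetric]
      by (simp add: right_diff_distrib)
    moreover have "(sqrt (w $ i))\<^sup>2 = w $ i"
      using assms(5) i by simp
    ultimately show ?thesis
      using i dims assms(4) by (simp add: power_mult_distrib power2_commute)
  qed
  then show ?thesis
    unfolding weighted_norm_sq_def using assms(4) by (intro sum.cong) auto
qed

lemma full_column_rank_posdef:
  assumes "d \<le> n" "h \<in> carrier_vec (d + 1)" "w \<in> carrier_vec (n + 1)"
    and rank: "full_column_rank (sqrt_diag w * mult_mat (n - d) h)"
  shows "posdef (n - d + 1) (gram (n + 1) (block_mat w h))"
proof (rule posdef_gram)
  fix v :: "nat \<Rightarrow> real" and l
  assume v: "\<And>i. i < n + 1 \<Longrightarrow> (\<Sum>l<n - d + 1. block_mat w h i l * v l) = 0"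
    and l: "l < n - d + 1"
  define u where "u = vec (n - d + 1) v"
  have u: "u \<in> carrier_vec (n - d + 1)" by (simp add: u_def)
  have M: "mult_mat (n - d) h \<in> carrier_mat (n + 1) (n - d + 1)"
    using assms by (auto simp: mult_mat_def)
  have S: "sqrt_diag w \<in> carrier_mat (n + 1) (n + 1)"
    using assms by (auto simp: sqrt_diag_def)
  have "sqrt_diag w * mult_mat (n - d) h *\<^sub>v u = sqrt_diag w *\<^sub>v (mult_mat (n - d) h *\<^sub>v u)"
    using S M u by (rule assoc_mult_mat_vec)
  also have "\<dots> = 0\<^sub>v (n + 1)"
  proof (rule eq_vecI)
    show "dim_vec (sqrt_diag w *\<^sub>v (mult_mat (n - d) h *\<^sub>v u)) = dim_vec (0\<^sub>v (n + 1) :: real vec)"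
      using S by simp
    fix i
    assume "i < dim_vec (0\<^sub>v (n + 1) :: real vec)"
    then have i: "i < n + 1" by simp
    have "(sqrt_diag w *\<^sub>v (mult_mat (n - d) h *\<^sub>v u)) $ i =
        sqrt (w $ i) * (mult_mat (n - d) h *\<^sub>v u) $ i"
      using assms(3) M i u by (intro sqrt_diag_mult_vec_index[of _ "n + 1"]) auto
    also have "\<dots> = (\<Sum>l<n - d + 1. block_mat w h i l * u $ l)"
      by (rule mult_mat_vec_index[OF assms(1,2) u i])
    also have "\<dots> = (\<Sum>l<n - d + 1. block_mat w h i l * v l)"
      by (intro sum.cong) (auto simp: u_def)
    finally show "(sqrt_diag w *\<^sub>v (mult_mat (n - d) h *\<^sub>v u)) $ i = 0\<^sub>v (n + 1) $ i"
      using v[OF i] i by simp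
  qed
  finally have "u = 0\<^sub>v (n - d + 1)"
    using full_column_rank_imp_injective[OF rank, of u] S M u by auto
  then show "v l = 0"
    using l unfolding u_def by (metis index_vec index_zero_vec(1))
qed

text \<open>Full column rank enters the calculus in this form, which visibly persists at nearby points.\<close>

definition regular_block :: "nat \<Rightarrow> nat \<Rightarrow> real vec \<Rightarrow> real vec \<Rightarrow> bool" where
  "regular_block n d w h \<longleftrightarrow> posdef (n - d + 1) (gram (n + 1) (block_mat w h))"

text \<open>For a regular block both systems have exactly one solution, so the choice operator selects the
  minimizing cofactor and its partial derivatives. The formulas for the derivatives are those of
  \<open>projected_residual_slopes\<close>.\<close>

definition block_sol :: "nat \<Rightarrow> nat \<Rightarrow> real vec \<Rightarrow> real vec \<Rightarrow> real vec \<Rightarrow> nat \<Rightarrow> real" where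
  "block_sol n d w p h =
     (SOME g. normal_eq (n + 1) (n - d + 1) (block_mat w h) (block_rhs w p) g)"

definition block_res :: "nat \<Rightarrow> nat \<Rightarrow> real vec \<Rightarrow> real vec \<Rightarrow> real vec \<Rightarrow> nat \<Rightarrow> real" where
  "block_res n d w p h =
     residual (n - d + 1) (block_mat w h) (block_rhs w p) (block_sol n d w p h)"

definition block_drhs :: "nat \<Rightarrow> nat \<Rightarrow> real vec \<Rightarrow> real vec \<Rightarrow> real vec \<Rightarrow> nat \<Rightarrow> nat \<Rightarrow> real" where
  "block_drhs n d w p h t j = (\<Sum>i<n + 1. shift_mat w t i j * block_res n d w p h i -
     block_mat w h i j * (\<Sum>l<n - d + 1. shift_mat w t i l * block_sol n d w p h l))"

definition block_dsol :: "nat \<Rightarrow> nat \<Rightarrow> real vec \<Rightarrow> real vec \<Rightarrow> real vec \<Rightarrow> nat \<Rightarrow> nat \<Rightarrow> real" where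
  "block_dsol n d w p h t =
     (SOME z. solves (n - d + 1) (gram (n + 1) (block_mat w h)) z (block_drhs n d w p h t))"

definition block_jac :: "nat \<Rightarrow> nat \<Rightarrow> real vec \<Rightarrow> real vec \<Rightarrow> real vec \<Rightarrow> nat \<Rightarrow> nat \<Rightarrow> real" where
  "block_jac n d w p h i t = - (\<Sum>l<n - d + 1. shift_mat w t i l * block_sol n d w p h l)
     - (\<Sum>l<n - d + 1. block_mat w h i l * block_dsol n d w p h t l)"

lemma block_sol_normal_eq:
  assumes "regular_block n d w h"
  shows "normal_eq (n + 1) (n - d + 1) (block_mat w h) (block_rhs w p) (block_sol n d w p h)"
  unfolding block_sol_def normal_eq_def
  by (rule someI_ex[OF posdef_solution_exists]) (use assms in \<open>simp add: regular_block_def\<close>)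

lemma block_dsol_solves:
  assumes "regular_block n d w h"
  shows "solves (n - d + 1) (gram (n + 1) (block_mat w h)) (block_dsol n d w p h t)
    (block_drhs n d w p h t)"
  unfolding block_dsol_def
  by (rule someI_ex[OF posdef_solution_exists]) (use assms in \<open>simp add: regular_block_def\<close>)

lemma block_mat_eventually:
  "\<forall>\<^sub>F x in vec_nhds h. block_mat w x = (\<lambda>i j. \<Sum>t<dim_vec h. x $ t * shift_mat w t i j)"
  using eventually_vec_nhds_carrier[of h] by eventually_elim (auto simp: block_mat_def fun_eq_iff)

lemma regular_block_eventually:
  assumes "regular_block n d w h"
  shows "\<forall>\<^sub>F x in vec_nhds h. regular_block n d w x"
proof -
  have "\<forall>\<^sub>F x in vec_nhds h.
      posdef (n - d + 1) (gram (n + 1) (\<lambda>i j. \<Sum>t<dim_vec h. x $ t * shift_mat w t i j))"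
    by (rule posdef_gram_eventually)
      (use assms in \<open>simp add: regular_block_def block_mat_def[abs_def]\<close>)
  with block_mat_eventually[of w h] show ?thesis
    by eventually_elim (simp add: regular_block_def)
qed

lemma block_res_slopes:
  assumes "regular_block n d w h"
  shows "has_slopes (\<lambda>x. block_res n d w p x i) (block_jac n d w p h i) h"
proof -
  let ?m = "n - d + 1"
  let ?B = "\<lambda>x i j. \<Sum>t<dim_vec h. x $ t * shift_mat w t i j"
  have B: "?B h i j = block_mat w h i j" for i j
    by (simp add: block_mat_def)
  have "has_slopes (\<lambda>x. residual ?m (?B x) (block_rhs w p) (block_sol n d w p x) i)
      (\<lambda>t. - (\<Sum>l<?m. shift_mat w t i l * block_sol n d w p h l)
        - (\<Sum>l<?m. ?B h i l * block_dsol n d w p h t l)) h"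
  proof (rule projected_residual_slopes[where r = "n + 1"])
    show "posdef ?m (gram (n + 1) (?B h))"
      using assms unfolding B regular_block_def .
    from regular_block_eventually[OF assms] block_mat_eventually[of w h]
    show "\<forall>\<^sub>F x in vec_nhds h. normal_eq (n + 1) ?m (?B x) (block_rhs w p) (block_sol n d w p x)"
      by eventually_elim (metis block_sol_normal_eq)
    show "solves ?m (gram (n + 1) (?B h)) (block_dsol n d w p h t)
        (\<lambda>j. \<Sum>i<n + 1. shift_mat w t i j * residual ?m (?B h) (block_rhs w p) (block_sol n d w p h) i -
          ?B h i j * (\<Sum>l<?m. shift_mat w t i l * block_sol n d w p h l))" for t
      unfolding B using block_dsol_solves[OF assms, of p t]
      unfolding block_drhs_def[abs_def] block_res_def .
  qed
  then have "has_slopes (\<lambda>x. residual ?m (?B x) (block_rhs w p) (block_sol n d w p x) i)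
      (block_jac n d w p h i) h"
    by (simp only: B block_jac_def[abs_def])
  then show ?thesis
    by (rule has_slopes_cong)
      (use block_mat_eventually[of w h] in eventually_elim, simp add: block_res_def)
qed

text \<open>For \<open>d = 0\<close> the matrix of a block is diagonal and invertible, so that its transpose has trivial
  kernel. The residual and all columns of its Jacobian lie in this kernel.\<close>

lemma square_block_eq_zero:
  assumes "regular_block n 0 w h" "dim_vec h = 1" "\<forall>j<n + 1. (\<Sum>i<n + 1. block_mat w h i j * v i) = 0"
    and "i < n + 1"
  shows "v i = 0"
proof -
  have diag: "block_mat w h i j = (if i = j then block_mat w h i i else 0)" for i j
    using assms(2) by (auto simp: block_mat_eq)
  have col: "(\<Sum>l<n + 1. block_mat w h l i * u l) = block_mat w h i i * u i" for u
  proof -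
    have "(\<Sum>l<n + 1. block_mat w h l i * u l) =
        (\<Sum>l\<in>{..<n + 1}. if l = i then block_mat w h i i * u i else 0)"
      by (intro sum.cong refl) (subst diag, simp)
    then show ?thesis using assms(4) by (simp del: sum.lessThan_Suc)
  qed
  have "0 < (\<Sum>a<n + 1. \<Sum>b<n + 1. (if a = i then 1 else 0) * gram (n + 1) (block_mat w h) a b *
      (if b = i then 1 else 0))"
    using assms(1) posdef_pos[of "n + 1" _ i "\<lambda>a. if a = i then 1 else 0"] assms(4)
    by (simp add: regular_block_def del: sum.lessThan_Suc)
  also have "\<dots> = (\<Sum>a<n + 1. (\<Sum>b<n + 1. block_mat w h a b * (if b = i then 1 else 0))\<^sup>2)"
    by (rule gram_quadratic)
  also have "\<dots> = (\<Sum>a<n + 1. if a = i then (block_mat w h i i)\<^sup>2 else 0)"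
  proof (intro sum.cong refl)
    fix a
    have "(\<Sum>b<n + 1. block_mat w h a b * (if b = i then 1 else 0)) =
        (\<Sum>b\<in>{..<n + 1}. if b = i then block_mat w h a i else 0)"
      by (intro sum.cong) auto
    then show "(\<Sum>b<n + 1. block_mat w h a b * (if b = i then 1 else 0))\<^sup>2 =
        (if a = i then (block_mat w h i i)\<^sup>2 else 0)"
      using assms(4) diag[of a i] by (simp del: sum.lessThan_Suc)
  qed
  finally have "block_mat w h i i \<noteq> 0"
    using assms(4) by (auto simp del: sum.lessThan_Suc)
  with assms(3,4) col[of v] show ?thesis by auto
qed

lemma square_block_res_zero:
  assumes "regular_block n 0 w h" "dim_vec h = 1" "i < n + 1"
  shows "block_res n 0 w p h i = 0"
  using block_sol_normal_eq[OF assms(1), of p] assms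
  by (intro square_block_eq_zero[OF assms(1,2)])
    (auto simp: normal_eq_iff block_res_def simp del: sum.lessThan_Suc)

lemma square_block_jac_zero:
  assumes "regular_block n 0 w h" "dim_vec h = 1" "i < n + 1"
  shows "block_jac n 0 w p h i t = 0"
proof (rule square_block_eq_zero[OF assms(1,2) _ assms(3)], intro allI impI)
  fix j
  assume j: "j < n + 1"
  let ?u = "\<lambda>i. \<Sum>l<n + 1. shift_mat w t i l * block_sol n 0 w p h l"
  have "(\<Sum>i<n + 1. block_mat w h i j * block_jac n 0 w p h i t) =
      - (\<Sum>i<n + 1. block_mat w h i j * ?u i)
      - (\<Sum>i<n + 1. block_mat w h i j * (\<Sum>l<n + 1. block_mat w h i l * block_dsol n 0 w p h t l))"
    by (simp add: block_jac_def right_diff_distrib sum_subtractf sum_negf del: sum.lessThan_Suc)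
  also have "(\<Sum>i<n + 1. block_mat w h i j * (\<Sum>l<n + 1. block_mat w h i l * block_dsol n 0 w p h t l)) =
      block_drhs n 0 w p h t j"
    unfolding gram_mult[symmetric] using block_dsol_solves[OF assms(1), of p t] j
    by (simp add: solves_def del: sum.lessThan_Suc)
  also have "block_drhs n 0 w p h t j = - (\<Sum>i<n + 1. block_mat w h i j * ?u i)"
    using square_block_res_zero[OF assms(1,2)]
    by (simp add: block_drhs_def sum_negf del: sum.lessThan_Suc)
  finally show "(\<Sum>i<n + 1. block_mat w h i j * block_jac n 0 w p h i t) = 0"
    by simp
qed

section \<open>The joint minimum and its derivatives\<close>

definition admissible :: "nat list \<Rightarrow> nat \<Rightarrow> real vec list \<Rightarrow> real vec list \<Rightarrow> bool" where
  "admissible ns d ps ws \<longleftrightarrow> (\<forall>k<length ns. d \<le> ns ! k \<and> ps ! k \<in> carrier_vec (ns ! k + 1) \<and>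
     ws ! k \<in> carrier_vec (ns ! k + 1) \<and> (\<forall>j<ns ! k + 1. 0 \<le> ws ! k $ j))"

definition regular :: "nat list \<Rightarrow> nat \<Rightarrow> real vec list \<Rightarrow> real vec \<Rightarrow> bool" where
  "regular ns d ws h \<longleftrightarrow> h \<in> carrier_vec (d + 1) \<and>
     (\<forall>k<length ns. regular_block (ns ! k) d (ws ! k) h)"

definition optimal_cofactors ::
  "nat list \<Rightarrow> nat \<Rightarrow> real vec list \<Rightarrow> real vec list \<Rightarrow> real vec \<Rightarrow> real vec list" where
  "optimal_cofactors ns d ps ws h =
     map (\<lambda>k. vec (ns ! k - d + 1) (block_sol (ns ! k) d (ws ! k) (ps ! k) h)) [0..<length ns]"

definition optimal_cost ::
  "nat list \<Rightarrow> nat \<Rightarrow> real vec list \<Rightarrow> real vec list \<Rightarrow> real vec \<Rightarrow> real" where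
  "optimal_cost ns d ps ws h =
     (\<Sum>k<length ns. \<Sum>i<ns ! k + 1. (block_res (ns ! k) d (ws ! k) (ps ! k) h i)\<^sup>2)"

text \<open>The cost is a sum over independent blocks, and each block is split by the theorem of Pythagoras.
  This identifies the minimum, and it makes the minimizer unique because a positive definite Gram
  matrix leaves no room for a different cofactor.\<close>

lemma cost_pythagoras:
  assumes "admissible ns d ps ws" "regular ns d ws h" "gs \<in> cofactors ns d"
  shows "cost ns d ps ws h gs = optimal_cost ns d ps ws h + (\<Sum>k<length ns. \<Sum>i<ns ! k + 1.
    (\<Sum>l<ns ! k - d + 1. block_mat (ws ! k) h i l *
      (gs ! k $ l - block_sol (ns ! k) d (ws ! k) (ps ! k) h l))\<^sup>2)"
proof -
  let ?gap = "\<lambda>k. \<Sum>i<ns ! k + 1. (\<Sum>l<ns ! k - d + 1. block_mat (ws ! k) h i l *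
      (gs ! k $ l - block_sol (ns ! k) d (ws ! k) (ps ! k) h l))\<^sup>2"
  have "cost ns d ps ws h gs = (\<Sum>k<length ns.
      (\<Sum>i<ns ! k + 1. (block_res (ns ! k) d (ws ! k) (ps ! k) h i)\<^sup>2) + ?gap k)"
    unfolding cost_def
  proof (rule sum.cong)
    fix k
    assume "k \<in> {..<length ns}"
    then have k: "k < length ns" by simp
    have g: "gs ! k \<in> carrier_vec (ns ! k - d + 1)"
      using assms(3) k by (auto simp: cofactors_def list_all2_conv_all_nth)
    have "weighted_norm_sq (ws ! k) (mult_mat (ns ! k - d) h *\<^sub>v gs ! k - ps ! k) =
        (\<Sum>i<ns ! k + 1. (residual (ns ! k - d + 1) (block_mat (ws ! k) h) (block_rhs (ws ! k) (ps ! k))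
          (\<lambda>l. gs ! k $ l) i)\<^sup>2)"
      using assms(1,2) k g by (intro weighted_norm_sq_residual) (auto simp: admissible_def regular_def)
    also have "\<dots> = (\<Sum>i<ns ! k + 1. (block_res (ns ! k) d (ws ! k) (ps ! k) h i)\<^sup>2) +
        (\<Sum>i<ns ! k + 1. (\<Sum>l<ns ! k - d + 1. block_mat (ws ! k) h i l *
          (gs ! k $ l - block_sol (ns ! k) d (ws ! k) (ps ! k) h l))\<^sup>2)"
      unfolding block_res_def
      using assms(2) k by (intro normal_eq_pythagoras block_sol_normal_eq) (simp add: regular_def)
    finally show "weighted_norm_sq (ws ! k) (mult_mat (ns ! k - d) h *\<^sub>v gs ! k - ps ! k) =
        (\<Sum>i<ns ! k + 1. (block_res (ns ! k) d (ws ! k) (ps ! k) h i)\<^sup>2) +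
        (\<Sum>i<ns ! k + 1. (\<Sum>l<ns ! k - d + 1. block_mat (ws ! k) h i l *
          (gs ! k $ l - block_sol (ns ! k) d (ws ! k) (ps ! k) h l))\<^sup>2)" .
  qed simp
  then show ?thesis
    by (simp only: optimal_cost_def sum.distrib)
qed

lemma optimal_cofactors_in: "optimal_cofactors ns d ps ws h \<in> cofactors ns d"
  by (simp add: cofactors_def list_all2_conv_all_nth optimal_cofactors_def)

lemma cost_optimal:
  assumes "admissible ns d ps ws" "regular ns d ws h"
  shows "cost ns d ps ws h (optimal_cofactors ns d ps ws h) = optimal_cost ns d ps ws h"
  unfolding cost_pythagoras[OF assms optimal_cofactors_in]
  by (simp add: optimal_cofactors_def del: sum.lessThan_Suc)

lemma cost_ge_optimal:
  assumes "admissible ns d ps ws" "regular ns d ws h" "gs \<in> cofactors ns d"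
  shows "optimal_cost ns d ps ws h \<le> cost ns d ps ws h gs"
  unfolding cost_pythagoras[OF assms] by (simp add: sum_nonneg del: sum.lessThan_Suc)

lemma optimal_cofactors_unique:
  assumes "admissible ns d ps ws" "regular ns d ws h" "gs \<in> cofactors ns d"
    and "cost ns d ps ws h gs \<le> optimal_cost ns d ps ws h"
  shows "gs = optimal_cofactors ns d ps ws h"
proof (rule nth_equalityI)
  show "length gs = length (optimal_cofactors ns d ps ws h)"
    using assms(3) by (auto simp: cofactors_def optimal_cofactors_def dest: list_all2_lengthD)
  fix k
  assume "k < length gs"
  then have k: "k < length ns"
    using assms(3) by (auto simp: cofactors_def dest: list_all2_lengthD)
  let ?m = "ns ! k - d + 1" and ?sol = "block_sol (ns ! k) d (ws ! k) (ps ! k) h"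
  define gap where "gap k = (\<Sum>i<ns ! k + 1. (\<Sum>l<ns ! k - d + 1. block_mat (ws ! k) h i l *
      (gs ! k $ l - block_sol (ns ! k) d (ws ! k) (ps ! k) h l))\<^sup>2)" for k
  have "(\<Sum>k<length ns. gap k) \<le> 0"
    using assms(4) unfolding cost_pythagoras[OF assms(1-3)] gap_def by simp
  moreover have "gap k \<le> (\<Sum>k<length ns. gap k)"
    using k by (intro member_le_sum) (auto simp: gap_def simp del: sum.lessThan_Suc intro: sum_nonneg)
  ultimately have "gap k \<le> 0" by simp
  have "gs ! k $ l = ?sol l" if l: "l < ?m" for l
  proof (rule ccontr)
    assume "gs ! k $ l \<noteq> ?sol l"
    moreover have "posdef ?m (gram (ns ! k + 1) (block_mat (ws ! k) h))"
      using assms(2) k by (simp add: regular_def regular_block_def)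
    ultimately have "0 < gap k"
      unfolding gap_def gram_quadratic[symmetric]
      by (intro posdef_pos[where v = "\<lambda>l. gs ! k $ l - ?sol l", OF _ l]) simp_all
    with \<open>gap k \<le> 0\<close> show False by simp
  qed
  moreover have "gs ! k \<in> carrier_vec ?m"
    using assms(3) k by (auto simp: cofactors_def list_all2_conv_all_nth)
  ultimately show "gs ! k = optimal_cofactors ns d ps ws h ! k"
    using k by (auto simp: optimal_cofactors_def)
qed

lemma f1_eq_optimal_cost:
  assumes "admissible ns d ps ws" "regular ns d ws h"
  shows "f1 ns d ps ws h = optimal_cost ns d ps ws h"
  unfolding f1_def
proof (rule Least_equality)
  show "optimal_cost ns d ps ws h \<in> cost ns d ps ws h ` cofactors ns d"
    using cost_optimal[OF assms] optimal_cofactors_in by (metis image_eqI)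
qed (use cost_ge_optimal[OF assms] in auto)

lemma g_min_eq_optimal_cofactors:
  assumes "admissible ns d ps ws" "regular ns d ws h"
  shows "g_min ns d ps ws h = optimal_cofactors ns d ps ws h"
proof -
  let ?P = "\<lambda>gs. is_arg_min (cost ns d ps ws h) (\<lambda>gs. gs \<in> cofactors ns d) gs"
  have "?P (optimal_cofactors ns d ps ws h)"
    using optimal_cofactors_in cost_ge_optimal[OF assms] cost_optimal[OF assms]
    by (auto simp: is_arg_min_def not_less)
  moreover have "gs = optimal_cofactors ns d ps ws h" if "?P gs" for gs
    using that optimal_cofactors_in[of ns d ps ws h]
    by (intro optimal_cofactors_unique[OF assms])
      (auto simp: is_arg_min_def not_less cost_optimal[OF assms])
  ultimately show ?thesis
    unfolding g_min_def arg_min_on_def arg_min_def by (rule some_equality)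
qed

text \<open>The positions in the stacked vector as pairs of block and coordinate. The coefficients of the
  polynomials and the weights are read in the same order.\<close>

definition entries :: "nat list \<Rightarrow> (nat \<times> nat) list" where
  "entries ns = concat (map (\<lambda>k. map (Pair k) [0..<ns ! k + 1]) [0..<length ns])"

lemma set_entries: "set (entries ns) = (SIGMA k:{..<length ns}. {..<ns ! k + 1})"
  by (auto simp: entries_def simp del: upt_Suc)

lemma list_of_vec_foldr_append:
  "list_of_vec (foldr (@\<^sub>v) vs vNil) = concat (map list_of_vec vs)"
  by (induction vs) auto

lemma list_of_g_star:
  assumes "admissible ns d ps ws" "regular ns d ws h"
  shows "list_of_vec (g_star ns d ps ws h) =
    map (\<lambda>(k, i). block_res (ns ! k) d (ws ! k) (ps ! k) h i) (entries ns)"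
proof -
  have block: "list_of_vec (sqrt_diag (ws ! k) *\<^sub>v
        (ps ! k - mult_mat (ns ! k - d) h *\<^sub>v (g_min ns d ps ws h ! k))) =
      map (block_res (ns ! k) d (ws ! k) (ps ! k) h) [0..<ns ! k + 1]" if k: "k < length ns" for k
  proof -
    let ?g = "optimal_cofactors ns d ps ws h ! k"
    let ?v = "sqrt_diag (ws ! k) *\<^sub>v (ps ! k - mult_mat (ns ! k - d) h *\<^sub>v ?g)"
    have g: "?g = vec (ns ! k - d + 1) (block_sol (ns ! k) d (ws ! k) (ps ! k) h)"
      using k by (simp add: optimal_cofactors_def)
    have "dim_vec ?v = ns ! k + 1"
      using assms(1) k by (simp add: sqrt_diag_def mat_diag_def admissible_def)
    moreover have "?v $ i = block_res (ns ! k) d (ws ! k) (ps ! k) h i" if "i < ns ! k + 1" for i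
    proof -
      have "?v $ i = residual (ns ! k - d + 1) (block_mat (ws ! k) h) (block_rhs (ws ! k) (ps ! k))
          (\<lambda>l. ?g $ l) i"
        using assms k that
        by (intro weighted_residual_index) (auto simp: admissible_def regular_def g)
      then show ?thesis
        by (simp add: residual_def block_res_def g del: sum.lessThan_Suc)
    qed
    ultimately show ?thesis
      unfolding g_min_eq_optimal_cofactors[OF assms] list_of_vec_map by simp
  qed
  then show ?thesis
    by (simp add: g_star_def list_of_vec_foldr_append entries_def map_concat comp_def del: upt_Suc)
      (intro arg_cong[where f = concat] map_cong refl, simp add: block del: upt_Suc)
qed

lemma regular_eventually:
  assumes "regular ns d ws h"
  shows "\<forall>\<^sub>F x in vec_nhds h. regular ns d ws x"
proof -
  have "\<forall>\<^sub>F x in vec_nhds h. \<forall>k\<in>{..<length ns}. regular_block (ns ! k) d (ws ! k) x"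
    using assms by (intro eventually_ball_finite) (auto simp: regular_def intro: regular_block_eventually)
  with eventually_vec_nhds_carrier[of h] show ?thesis
    by eventually_elim (use assms in \<open>auto simp: regular_def\<close>)
qed

lemma optimal_cost_entries:
  "optimal_cost ns d ps ws h =
    (\<Sum>(k, i)\<in>set (entries ns). (block_res (ns ! k) d (ws ! k) (ps ! k) h i)\<^sup>2)"
  unfolding optimal_cost_def set_entries by (rule sum.Sigma) auto

lemma f1_has_gradient:
  assumes "admissible ns d ps ws" "regular ns d ws h"
  shows "has_gradient (f1 ns d ps ws) (vec (d + 1) (\<lambda>t. \<Sum>(k, i)\<in>set (entries ns).
    2 * (block_res (ns ! k) d (ws ! k) (ps ! k) h i * block_jac (ns ! k) d (ws ! k) (ps ! k) h i t))) h"
proof -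
  have "has_slopes (\<lambda>x. \<Sum>ki\<in>set (entries ns).
        (block_res (ns ! fst ki) d (ws ! fst ki) (ps ! fst ki) x (snd ki))\<^sup>2)
      (\<lambda>t. \<Sum>ki\<in>set (entries ns). 2 * (block_res (ns ! fst ki) d (ws ! fst ki) (ps ! fst ki) h (snd ki) *
        block_jac (ns ! fst ki) d (ws ! fst ki) (ps ! fst ki) h (snd ki) t)) h"
    using assms(2)
    by (intro has_slopes_sum has_slopes_square block_res_slopes) (auto simp: regular_def set_entries)
  moreover have "\<forall>\<^sub>F x in vec_nhds h. f1 ns d ps ws x = (\<Sum>ki\<in>set (entries ns).
      (block_res (ns ! fst ki) d (ws ! fst ki) (ps ! fst ki) x (snd ki))\<^sup>2)"
    using regular_eventually[OF assms(2)]
    by eventually_elim (simp add: f1_eq_optimal_cost[OF assms(1)] optimal_cost_entries case_prod_beta)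
  ultimately have "has_slopes (f1 ns d ps ws) (\<lambda>t. \<Sum>ki\<in>set (entries ns).
      2 * (block_res (ns ! fst ki) d (ws ! fst ki) (ps ! fst ki) h (snd ki) *
        block_jac (ns ! fst ki) d (ws ! fst ki) (ps ! fst ki) h (snd ki) t)) h"
    by (rule has_slopes_cong)
  moreover have "dim_vec h = d + 1"
    using assms(2) by (simp add: regular_def)
  ultimately show ?thesis
    using has_slopes_imp_has_gradient[of "f1 ns d ps ws" _ h] by (simp add: case_prod_beta)
qed

definition jacobian :: "nat list \<Rightarrow> nat \<Rightarrow> real vec list \<Rightarrow> real vec list \<Rightarrow> real vec \<Rightarrow> real mat" where
  "jacobian ns d ps ws h = mat (length (entries ns)) (d + 1) (\<lambda>(a, t).
     case entries ns ! a of (k, i) \<Rightarrow> block_jac (ns ! k) d (ws ! k) (ps ! k) h i t)"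

lemma g_star_has_jacobian:
  assumes "admissible ns d ps ws" "regular ns d ws h"
  shows "has_jacobian (g_star ns d ps ws) (jacobian ns d ps ws h) h"
  unfolding has_jacobian_def
proof (intro conjI allI impI)
  have h: "dim_vec h = d + 1"
    using assms(2) by (simp add: regular_def)
  have "dim_vec (g_star ns d ps ws h) = length (entries ns)"
    using arg_cong[OF list_of_g_star[OF assms], of length] by simp
  then show "jacobian ns d ps ws h \<in> carrier_mat (dim_vec (g_star ns d ps ws h)) (dim_vec h)"
    by (simp add: jacobian_def h)
  fix a
  assume "a < dim_row (jacobian ns d ps ws h)"
  then have a: "a < length (entries ns)"
    by (simp add: jacobian_def)
  obtain k i where ki: "entries ns ! a = (k, i)" by fastforce
  then have k: "k < length ns"
    using nth_mem[OF a] by (auto simp: set_entries)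
  have "\<forall>\<^sub>F x in vec_nhds h. g_star ns d ps ws x $ a = block_res (ns ! k) d (ws ! k) (ps ! k) x i"
    using regular_eventually[OF assms(2)]
  proof eventually_elim
    case (elim x)
    show ?case
      unfolding list_of_vec_index[symmetric] list_of_g_star[OF assms(1) elim] using a ki by simp
  qed
  moreover have "has_slopes (\<lambda>x. block_res (ns ! k) d (ws ! k) (ps ! k) x i)
      (block_jac (ns ! k) d (ws ! k) (ps ! k) h i) h"
    using assms(2) k by (intro block_res_slopes) (simp add: regular_def)
  ultimately have "has_gradient (\<lambda>x. g_star ns d ps ws x $ a)
      (vec (dim_vec h) (block_jac (ns ! k) d (ws ! k) (ps ! k) h i)) h"
    by (intro has_slopes_imp_has_gradient) (rule has_slopes_cong)
  moreover have "row (jacobian ns d ps ws h) a = vec (dim_vec h) (block_jac (ns ! k) d (ws ! k) (ps ! k) h i)"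
    using a ki h by (auto simp: jacobian_def)
  ultimately show "has_gradient (\<lambda>x. g_star ns d ps ws x $ a) (row (jacobian ns d ps ws h) a) h"
    by simp
qed

lemma concat_jacobian:
  "concat (mat_to_list (jacobian ns d ps ws h)) = concat (map (\<lambda>(k, i).
    map (block_jac (ns ! k) d (ws ! k) (ps ! k) h i) [0..<d + 1]) (entries ns))"
proof -
  have "mat_to_list (jacobian ns d ps ws h) =
      map (\<lambda>(k, i). map (block_jac (ns ! k) d (ws ! k) (ps ! k) h i) [0..<d + 1]) (entries ns)"
    by (rule nth_equalityI)
      (auto simp: mat_to_list_def jacobian_def split: prod.splits simp del: upt_Suc intro!: nth_equalityI)
  then show ?thesis by simp
qed

lemma concat_list_of_vec:
  assumes "length ps = length ns" "\<And>k. k < length ns \<Longrightarrow> ps ! k \<in> carrier_vec (ns ! k + 1)"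
  shows "concat (map list_of_vec ps) = map (\<lambda>(k, i). ps ! k $ i) (entries ns)"
proof -
  have "map list_of_vec ps = map (\<lambda>k. map (\<lambda>i. ps ! k $ i) [0..<ns ! k + 1]) [0..<length ns]"
  proof (rule nth_equalityI)
    fix k
    assume "k < length (map list_of_vec ps)"
    then have k: "k < length ns"
      using assms(1) by simp
    have "dim_vec (ps ! k) = ns ! k + 1"
      using assms(2)[OF k] by simp
    with k assms(1) show "map list_of_vec ps ! k =
        map (\<lambda>k. map (\<lambda>i. ps ! k $ i) [0..<ns ! k + 1]) [0..<length ns] ! k"
      by (simp add: list_of_vec_map del: upt_Suc)
  qed (use assms(1) in simp)
  then show ?thesis
    by (simp add: entries_def map_concat comp_def del: upt_Suc)
qed

section \<open>Flops\<close>

context straight_line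
begin

lemma derives_sparse_sum:
  assumes "finite K" "K' \<subseteq> K" "\<And>k. k \<in> K' \<Longrightarrow> derives F a {f k}"
    and "\<And>k \<theta>. \<theta> \<in> D \<Longrightarrow> k \<in> K - K' \<Longrightarrow> f k \<theta> = 0"
    and "card K' * (a + 1) \<le> b"
  shows "derives F b {\<lambda>\<theta>. \<Sum>k\<in>K. f k \<theta>}"
proof -
  have "derives F b {\<lambda>\<theta>. \<Sum>k\<in>K'. f k \<theta>}"
    using finite_subset[OF assms(2,1)] assms(3,5) by (rule derives_sum)
  then show ?thesis
  proof (rule derives_cong)
    show "(\<Sum>k\<in>K. f k \<theta>) = (\<Sum>k\<in>K'. f k \<theta>)" if "\<theta> \<in> D" for \<theta>
      using assms(1,2,4) that by (intro sum.mono_neutral_right) auto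
  qed
qed

lemma derives_lift: "derives F a {f} \<Longrightarrow> derives (F \<union> S) a {f}"
  by (rule derives_weaken) auto

lemma derives_stored: "f \<in> S \<Longrightarrow> derives (F \<union> S) 0 {f}"
  by (rule derives_member) simp

text \<open>The cost of one block. Column \<open>j\<close> of \<open>B\<close> is supported on the rows \<open>j, \<dots>, j + d\<close>, so every inner
  product has at most \<open>d + 1\<close> terms and the Gram matrix \<open>A\<close> has bandwidth \<open>d\<close>. The dominant costs,
  all of order \<open>d\<^sup>2 n\<close>, are forming \<open>A\<close>, eliminating, and evaluating the \<open>d + 1\<close> right-hand sides
  and columns of the Jacobian. The sets \<open>S1\<close> to \<open>S7\<close> are the successive stages of the program:
  the data of the least squares problem; the normal equations; the cofactor \<open>g\<close>; the residual \<open>e\<close>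
  and the products \<open>u\<^sub>t = dB\<^sub>t g\<close>; the right-hand sides \<open>y\<^sub>t\<close> for the derivatives \<open>x\<^sub>t\<close> of the
  cofactor; these derivatives; the Jacobian \<open>J\<close>.\<close>

lemma derives_block:
  fixes w p h :: "'a \<Rightarrow> real vec"
  assumes d: "1 \<le> d" "d \<le> n"
    and W: "\<And>i. i < n + 1 \<Longrightarrow> derives F 0 {\<lambda>\<theta>. w \<theta> $ i}"
    and P: "\<And>i. i < n + 1 \<Longrightarrow> derives F 0 {\<lambda>\<theta>. p \<theta> $ i}"
    and H: "\<And>t. t < d + 1 \<Longrightarrow> derives F 0 {\<lambda>\<theta>. h \<theta> $ t}"
    and dim: "\<And>\<theta>. \<theta> \<in> D \<Longrightarrow> dim_vec (h \<theta>) = d + 1"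
    and nonneg: "\<And>\<theta> i. \<theta> \<in> D \<Longrightarrow> i < n + 1 \<Longrightarrow> 0 \<le> w \<theta> $ i"
    and reg: "\<And>\<theta>. \<theta> \<in> D \<Longrightarrow> regular_block n d (w \<theta>) (h \<theta>)"
  shows "derives F (113 * (d\<^sup>2 * n))
    ((\<lambda>i \<theta>. block_res n d (w \<theta>) (p \<theta>) (h \<theta>) i) ` {..<n + 1} \<union>
     (\<lambda>(i, t) \<theta>. block_jac n d (w \<theta>) (p \<theta>) (h \<theta>) i t) ` ({..<n + 1} \<times> {..<d + 1}))"
proof -
  define r where "r = n + 1"
  define m where "m = n - d + 1"
  define B where "B i j \<theta> = block_mat (w \<theta>) (h \<theta>) i j" for i j \<theta>
  define c where "c i \<theta> = block_rhs (w \<theta>) (p \<theta>) i" for i \<theta>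
  define A where "A j l \<theta> = gram r (block_mat (w \<theta>) (h \<theta>)) j l" for j l \<theta>
  define b where "b j \<theta> = (\<Sum>i<r. B i j \<theta> * c i \<theta>)" for j \<theta>
  define g where "g l \<theta> = block_sol n d (w \<theta>) (p \<theta>) (h \<theta>) l" for l \<theta>
  define e where "e i \<theta> = block_res n d (w \<theta>) (p \<theta>) (h \<theta>) i" for i \<theta>
  define s where "s t i j \<theta> = shift_mat (w \<theta>) t i j" for t i j \<theta>
  define u where "u t i \<theta> = (\<Sum>l<m. s t i l \<theta> * g l \<theta>)" for t i \<theta>
  define y where "y j t \<theta> = block_drhs n d (w \<theta>) (p \<theta>) (h \<theta>) t j" for j t \<theta>
  define x where "x l t \<theta> = block_dsol n d (w \<theta>) (p \<theta>) (h \<theta>) t l" for l t \<theta>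
  define J where "J i t \<theta> = block_jac n d (w \<theta>) (p \<theta>) (h \<theta>) i t" for i t \<theta>

  have A_eq: "A j l \<theta> = (\<Sum>i<r. B i j \<theta> * B i l \<theta>)" for j l \<theta>
    by (simp add: A_def B_def gram_def)
  have e_eq: "e i \<theta> = c i \<theta> - (\<Sum>l<m. B i l \<theta> * g l \<theta>)" for i \<theta>
    by (simp add: e_def c_def B_def g_def m_def block_res_def residual_def)
  have y_eq: "y j t \<theta> = (\<Sum>i<r. s t i j \<theta> * e i \<theta> - B i j \<theta> * u t i \<theta>)" for j t \<theta>
    by (simp add: y_def s_def e_def B_def u_def g_def m_def r_def block_drhs_def)
  have J_eq: "J i t \<theta> = 0 - u t i \<theta> - (\<Sum>l<m. B i l \<theta> * x l t \<theta>)" for i t \<theta>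
    by (simp add: J_def s_def u_def g_def B_def x_def m_def block_jac_def)
  have B_band: "B i j \<theta> = 0" if "\<theta> \<in> D" "\<not> (j \<le> i \<and> i \<le> j + d)" for i j \<theta>
    using that dim[of \<theta>] by (auto simp: B_def block_mat_eq)
  have s_band: "s t i j \<theta> = 0" if "i \<noteq> j + t" for t i j \<theta>
    using that by (simp add: s_def shift_mat_def)

  have col: "{j..j + d} \<subseteq> {..<r}" if "j < m" for j
    using that d by (auto simp: m_def r_def)
  \<comment> \<open>the columns that can be nonzero in row \<open>i\<close>\<close>
  define row where "row i = {l. l < m \<and> l \<le> i \<and> i \<le> l + d}" for i
  have row: "row i \<subseteq> {..<m}" "finite (row i)" for i
    by (auto simp: row_def)
  have card_row: "card (row i) \<le> d + 1" for i
  proof -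
    have "row i \<subseteq> {i - d..i}"
      by (auto simp: row_def)
    then show ?thesis
      using card_mono[of "{i - d..i}" "row i"] by auto
  qed

  have S: "derives F 1 {s t i j}" if "i < r" for t i j
  proof (cases "i = j + t")
    case True
    have "derives F (0 + 1) {\<lambda>\<theta>. sqrt (w \<theta> $ i)}"
      using that nonneg by (intro derives_sqrt W) (auto simp: r_def)
    then show ?thesis
      using True by (simp add: s_def[abs_def] shift_mat_def)
  next
    case False
    then have "derives F 0 {s t i j}"
      using derives_zero by (rule_tac derives_cong) (auto simp: s_band)
    then show ?thesis
      by (rule derives_weaken) auto
  qed

  define S1 where "S1 = (\<lambda>(j, t). B (j + t) j) ` ({..<m} \<times> {..<d + 1}) \<union> c ` {..<r}"
  have D1: "derives F (m * (d + 1) * 2 + r * 2) S1"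
    unfolding S1_def
  proof (intro derives_Un derives_image[where a = 2])
    fix jt
    assume "jt \<in> {..<m} \<times> {..<d + 1}"
    then obtain j t where jt: "jt = (j, t)" "j < m" "t < d + 1" by auto
    then have i: "j + t < r"
      using d by (auto simp: m_def r_def)
    have "derives F (1 + 0 + 1) {\<lambda>\<theta>. s t (j + t) j \<theta> * h \<theta> $ t}"
      by (intro derives_mult S H i jt)
    then have "derives F 2 {\<lambda>\<theta>. s t (j + t) j \<theta> * h \<theta> $ t}"
      by (rule derives_weaken) auto
    then have "derives F 2 {B (j + t) j}"
      by (rule_tac derives_cong[of _ _ "\<lambda>\<theta>. s t (j + t) j \<theta> * h \<theta> $ t"])
        (use jt dim in \<open>auto simp: B_def block_mat_eq s_def shift_mat_def\<close>)
    then show "derives F 2 {case jt of (j, t) \<Rightarrow> B (j + t) j}"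
      by (simp add: jt)
  next
    fix i
    assume "i \<in> {..<r}"
    then have i: "i < r" by simp
    have "derives F (1 + 0 + 1) {\<lambda>\<theta>. s 0 i i \<theta> * p \<theta> $ i}"
      using i by (intro derives_mult S P) (auto simp: r_def)
    then show "derives F 2 {c i}"
      by (rule derives_weaken) (auto simp: c_def[abs_def] block_rhs_def s_def shift_mat_def)
  qed auto
  have B1: "derives (F \<union> S1) 0 {B i j}" if "j < m" for i j
  proof (cases "j \<le> i \<and> i \<le> j + d")
    case True
    with that have "B (j + (i - j)) j \<in> S1"
      by (auto simp: S1_def intro!: image_eqI[of _ _ "(j, i - j)"])
    with True show ?thesis
      by (intro derives_stored) simp
  next
    case False
    then show ?thesis
      by (intro derives_cong[OF derives_zero]) (auto simp: B_band)
  qed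
  have c1: "derives (F \<union> S1) 0 {c i}" if "i < r" for i
    using that by (intro derives_stored) (auto simp: S1_def)

  define S2 where "S2 = (\<lambda>(j, t). A j (j + t)) ` {(j, t). j < m \<and> t < d + 1 \<and> j + t < m} \<union> b ` {..<m}"
  have "derives (F \<union> S1) (m * (d + 1) * (2 * (d + 1)) + m * (2 * (d + 1))) S2"
    unfolding S2_def
  proof (intro derives_Un derives_image[where a = "2 * (d + 1)"])
    fix jt
    assume "jt \<in> {(j, t). j < m \<and> t < d + 1 \<and> j + t < m}"
    then obtain j t where jt: "jt = (j, t)" "j < m" "j + t < m" by auto
    have "derives (F \<union> S1) (0 + 0 + 1) {\<lambda>\<theta>. B i j \<theta> * B i (j + t) \<theta>}" for i
      by (intro derives_mult B1 jt)
    then have "derives (F \<union> S1) (2 * (d + 1)) {\<lambda>\<theta>. \<Sum>i<r. B i j \<theta> * B i (j + t) \<theta>}"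
      using col[OF jt(2)]
      by (intro derives_sparse_sum[where K' = "{j..j + d}" and a = 1]) (auto simp: B_band)
    then show "derives (F \<union> S1) (2 * (d + 1)) {case jt of (j, t) \<Rightarrow> A j (j + t)}"
      by (simp add: jt A_eq[abs_def])
  next
    fix j
    assume "j \<in> {..<m}"
    then have j: "j < m" by simp
    have "derives (F \<union> S1) (0 + 0 + 1) {\<lambda>\<theta>. B i j \<theta> * c i \<theta>}" if "i < r" for i
      by (intro derives_mult B1 c1 j that)
    then show "derives (F \<union> S1) (2 * (d + 1)) {b j}"
      unfolding b_def[abs_def] using col[OF j]
      by (intro derives_sparse_sum[where K' = "{j..j + d}" and a = 1]) (auto simp: B_band)
  next
    show "finite {(j, t). j < m \<and> t < d + 1 \<and> j + t < m}"
      by (rule finite_subset[of _ "{..<m} \<times> {..<d + 1}"]) auto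
    have "card {(j, t). j < m \<and> t < d + 1 \<and> j + t < m} \<le> card ({..<m} \<times> {..<d + 1})"
      by (intro card_mono) auto
    then show "card {(j, t). j < m \<and> t < d + 1 \<and> j + t < m} * (2 * (d + 1)) \<le> m * (d + 1) * (2 * (d + 1))"
      by (intro mult_right_mono) auto
  qed auto
  note D2 = derives_cut[OF D1 this]
  have A_band: "A j l \<theta> = 0" if "\<theta> \<in> D" "j + d < l \<or> l + d < j" for j l \<theta>
    unfolding A_eq
  proof (intro sum.neutral ballI)
    fix i
    have "\<not> (j \<le> i \<and> i \<le> j + d) \<or> \<not> (l \<le> i \<and> i \<le> l + d)"
      using that(2) by linarith
    then show "B i j \<theta> * B i l \<theta> = 0"
      using B_band[OF that(1)] by auto
  qed
  \<comment> \<open>only the upper half of the band is computed, and symmetry gives the rest\<close>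
  have A2: "derives (F \<union> (S1 \<union> S2)) 0 {A j l}" if "j < m" "l < m" for j l
  proof -
    have upper: "derives (F \<union> (S1 \<union> S2)) 0 {A j l}" if "j < m" "l < m" "j \<le> l" for j l
    proof (cases "l \<le> j + d")
      case True
      with that have "A j (j + (l - j)) \<in> S2"
        by (auto simp: S2_def intro!: image_eqI[of _ _ "(j, l - j)"])
      with that show ?thesis
        by (intro derives_stored) simp
    next
      case False
      then show ?thesis
        by (intro derives_cong[OF derives_zero]) (auto simp: A_band)
    qed
    have "A j l = A l j"
      by (simp add: A_def gram_sym fun_eq_iff)
    then show ?thesis
      using upper[of j l] upper[of l j] that by (cases "j \<le> l") auto
  qed
  have b2: "derives (F \<union> (S1 \<union> S2)) 0 {b j}" if "j < m" for j
    using that by (intro derives_stored) (auto simp: S2_def)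
  have pd: "posdef m (\<lambda>j l. A j l \<theta>)" if "\<theta> \<in> D" for \<theta>
    using reg[OF that] by (simp add: regular_block_def A_def m_def r_def)

  define S3 where "S3 = (\<lambda>(l, t). g l) ` ({..<m} \<times> {..<1::nat})"
  have "derives (F \<union> (S1 \<union> S2)) (m * (3 * d\<^sup>2 + (5 * d + 2) * 1)) S3"
    unfolding S3_def
  proof (rule banded_solve[where A = A and R = "\<lambda>j t. b j"])
    show "solves m (\<lambda>j l. A j l \<theta>) (\<lambda>l. g l \<theta>) (\<lambda>j. b j \<theta>)" if "\<theta> \<in> D" for \<theta>
      using block_sol_normal_eq[OF reg[OF that], of "p \<theta>"]
      by (simp add: normal_eq_def A_def g_def b_def B_def c_def m_def r_def)
  qed (use A2 b2 pd A_band in auto)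
  note D3 = derives_cut[OF D2 this]
  let ?F3 = "F \<union> (S1 \<union> S2 \<union> S3)"
  have g3: "derives ?F3 0 {g l}" if "l < m" for l
    using that by (intro derives_stored) (auto simp: S3_def)
  have B3: "derives ?F3 0 {B i j}" if "j < m" for i j
    using B1[OF that] by (rule derives_weaken) auto
  have c3: "derives ?F3 0 {c i}" if "i < r" for i
    using c1[OF that] by (rule derives_weaken) auto

  define S4 where "S4 = e ` {..<r} \<union> (\<lambda>(i, t). u t i) ` ({..<r} \<times> {..<d + 1})"
  have "derives ?F3 (r * (2 * (d + 1) + 1) + r * (d + 1) * 3) S4"
    unfolding S4_def
  proof (intro derives_Un derives_image)
    fix i
    assume "i \<in> {..<r}"
    then have i: "i < r" by simp
    have "derives ?F3 (0 + 0 + 1) {\<lambda>\<theta>. B i l \<theta> * g l \<theta>}" if "l < m" for l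
      by (intro derives_mult B3 g3 that)
    then have "derives ?F3 (2 * (d + 1)) {\<lambda>\<theta>. \<Sum>l<m. B i l \<theta> * g l \<theta>}"
      using row[of i] card_row[of i]
      by (intro derives_sparse_sum[where K' = "row i" and a = 1]) (auto simp: row_def B_band)
    then have "derives ?F3 (0 + 2 * (d + 1) + 1) {e i}"
      unfolding e_eq[abs_def] by (intro derives_diff c3 i)
    then show "derives ?F3 (2 * (d + 1) + 1) {e i}"
      by simp
  next
    fix it
    assume "it \<in> {..<r} \<times> {..<d + 1}"
    then obtain i t where it: "it = (i, t)" "i < r" by auto
    have "derives ?F3 (1 + 0 + 1) {\<lambda>\<theta>. s t i l \<theta> * g l \<theta>}" if "l < m" for l
      by (intro derives_mult derives_lift S it g3 that)
    then have "derives ?F3 2 {\<lambda>\<theta>. s t i l \<theta> * g l \<theta>}" if "l < m" for l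
      using that by (simp add: numeral_2_eq_2)
    then have "derives ?F3 3 {u t i}"
      unfolding u_def[abs_def]
    proof (intro derives_sparse_sum[where K' = "{..<m} \<inter> {i - t}" and a = 2])
      have "card ({..<m} \<inter> {i - t}) \<le> card {i - t}"
        by (intro card_mono) auto
      then show "card ({..<m} \<inter> {i - t}) * (2 + 1) \<le> 3"
        by simp
    qed (auto simp: s_band)
    then show "derives ?F3 3 {case it of (i, t) \<Rightarrow> u t i}"
      by (simp add: it)
  qed auto
  note D4 = derives_cut[OF D3 this]
  let ?F4 = "F \<union> (S1 \<union> S2 \<union> S3 \<union> S4)"
  have e4: "derives ?F4 0 {e i}" if "i < r" for i
    using that by (intro derives_stored) (auto simp: S4_def)
  have u4: "derives ?F4 0 {u t i}" if "i < r" "t < d + 1" for i t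
    using that by (intro derives_stored) (auto simp: S4_def)
  have B4: "derives ?F4 0 {B i j}" if "j < m" for i j
    using B1[OF that] by (rule derives_weaken) auto

  define S5 where "S5 = (\<lambda>(j, t). y j t) ` ({..<m} \<times> {..<d + 1})"
  have "derives ?F4 (m * (d + 1) * (5 * (d + 1))) S5"
    unfolding S5_def
  proof (intro derives_image)
    fix jt
    assume "jt \<in> {..<m} \<times> {..<d + 1}"
    then obtain j t where jt: "jt = (j, t)" "j < m" "t < d + 1" by auto
    have "derives ?F4 (1 + 0 + 1 + (0 + 0 + 1) + 1) {\<lambda>\<theta>. s t i j \<theta> * e i \<theta> - B i j \<theta> * u t i \<theta>}"
      if "i < r" for i
      by (intro derives_diff derives_mult derives_lift S B4 e4 u4 jt that)
    then have "derives ?F4 4 {\<lambda>\<theta>. s t i j \<theta> * e i \<theta> - B i j \<theta> * u t i \<theta>}" if "i < r" for i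
      using that by (simp add: eval_nat_numeral)
    moreover have "s t i j \<theta> * e i \<theta> - B i j \<theta> * u t i \<theta> = 0"
      if "\<theta> \<in> D" "i \<in> {..<r} - {j..j + d}" for i \<theta>
      using that jt(3) by (auto simp: B_band s_band)
    ultimately have "derives ?F4 (5 * (d + 1)) {y j t}"
      unfolding y_eq[abs_def] using col[OF jt(2)]
      by (intro derives_sparse_sum[where K' = "{j..j + d}" and a = 4]) auto
    then show "derives ?F4 (5 * (d + 1)) {case jt of (j, t) \<Rightarrow> y j t}"
      by (simp add: jt)
  qed auto
  note D5 = derives_cut[OF D4 this]
  let ?F5 = "F \<union> (S1 \<union> S2 \<union> S3 \<union> S4 \<union> S5)"
  have A5: "derives ?F5 0 {A j l}" if "j < m" "l < m" for j l
    using A2[OF that] by (rule derives_weaken) auto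
  have y5: "derives ?F5 0 {y j t}" if "j < m" "t < d + 1" for j t
    using that by (intro derives_stored) (auto simp: S5_def)

  define S6 where "S6 = (\<lambda>(l, t). x l t) ` ({..<m} \<times> {..<d + 1})"
  have "derives ?F5 (m * (3 * d\<^sup>2 + (5 * d + 2) * (d + 1))) S6"
    unfolding S6_def
  proof (rule banded_solve[where A = A and R = y])
    show "solves m (\<lambda>j l. A j l \<theta>) (\<lambda>l. x l t \<theta>) (\<lambda>j. y j t \<theta>)" if "\<theta> \<in> D" for t \<theta>
      using block_dsol_solves[OF reg[OF that], of "p \<theta>" t]
      by (simp add: A_def x_def y_def m_def r_def)
  qed (use A5 y5 pd A_band in auto)
  note D6 = derives_cut[OF D5 this]
  let ?F6 = "F \<union> (S1 \<union> S2 \<union> S3 \<union> S4 \<union> S5 \<union> S6)"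
  have x6: "derives ?F6 0 {x l t}" if "l < m" "t < d + 1" for l t
    using that by (intro derives_stored) (auto simp: S6_def)
  have u6: "derives ?F6 0 {u t i}" if "i < r" "t < d + 1" for i t
    using u4[OF that] by (rule derives_weaken) auto
  have B6: "derives ?F6 0 {B i j}" if "j < m" for i j
    using B1[OF that] by (rule derives_weaken) auto

  define S7 where "S7 = (\<lambda>(i, t). J i t) ` ({..<r} \<times> {..<d + 1})"
  have "derives ?F6 (r * (d + 1) * (2 * (d + 1) + 2)) S7"
    unfolding S7_def
  proof (intro derives_image)
    fix it
    assume "it \<in> {..<r} \<times> {..<d + 1}"
    then obtain i t where it: "it = (i, t)" "i < r" "t < d + 1" by auto
    have "derives ?F6 (0 + 0 + 1) {\<lambda>\<theta>. B i l \<theta> * x l t \<theta>}" if "l < m" for l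
      by (intro derives_mult B6 x6 that it)
    then have "derives ?F6 (2 * (d + 1)) {\<lambda>\<theta>. \<Sum>l<m. B i l \<theta> * x l t \<theta>}"
      using row[of i] card_row[of i]
      by (intro derives_sparse_sum[where K' = "row i" and a = 1]) (auto simp: row_def B_band)
    then have "derives ?F6 (0 + 0 + 1 + 2 * (d + 1) + 1) {J i t}"
      unfolding J_eq[abs_def] by (intro derives_diff derives_zero u6 it)
    then show "derives ?F6 (2 * (d + 1) + 2) {case it of (i, t) \<Rightarrow> J i t}"
      by (simp add: it)
  qed auto
  note D7 = derives_cut[OF D6 this]

  have mn: "m \<le> n" and rn: "r \<le> 2 * n" and dd: "d + 1 \<le> 2 * d"
    using d by (auto simp: m_def r_def)
  show ?thesis
  proof (rule derives_weaken[OF D7])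
    let ?q = "d\<^sup>2 * n"
    \<comment> \<open>the counts are combinations of \<open>m\<close> and \<open>r\<close> times at most two factors \<open>d\<close> or \<open>d + 1\<close>\<close>
    have q: "d * n \<le> ?q" "n \<le> d * n"
      using d by (auto simp: power2_eq_square)
    have m1: "m * (d + 1) \<le> 2 * (d * n)"
      using mult_le_mono[OF mn dd] by (simp add: mult_ac)
    have m2: "m * (d + 1) * (d + 1) \<le> 4 * ?q"
      using mult_le_mono[OF m1 dd] by (simp add: power2_eq_square mult_ac)
    have m3: "m * d \<le> d * n" "m * d\<^sup>2 \<le> ?q"
      using mn by (simp_all add: mult.commute)
    have m4: "m * (d * (d + 1)) \<le> 2 * ?q"
    proof -
      have "m * (d * (d + 1)) = d * (m * (d + 1))"
        by (simp only: mult.left_commute)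
      also have "\<dots> \<le> d * (2 * (d * n))"
        using m1 by (rule mult_le_mono2)
      finally show ?thesis
        by (simp add: power2_eq_square)
    qed
    have r1: "r * (d + 1) \<le> 4 * (d * n)"
      using mult_le_mono[OF rn dd] by (simp add: mult_ac)
    have r2: "r * (d + 1) * (d + 1) \<le> 8 * ?q"
      using mult_le_mono[OF r1 dd] by (simp add: power2_eq_square mult_ac)
    have "m * (d + 1) * 2 + r * 2 +
        (m * (d + 1) * (2 * (d + 1)) + m * (2 * (d + 1))) +
        m * (3 * d\<^sup>2 + (5 * d + 2) * 1) +
        (r * (2 * (d + 1) + 1) + r * (d + 1) * 3) +
        m * (d + 1) * (5 * (d + 1)) +
        m * (3 * d\<^sup>2 + (5 * d + 2) * (d + 1)) +
        r * (d + 1) * (2 * (d + 1) + 2) =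
      2 * (m * (d + 1)) + 3 * r + 7 * (m * (d + 1) * (d + 1)) + 4 * (m * (d + 1)) +
        6 * (m * d\<^sup>2) + 5 * (m * d) + 2 * m + 7 * (r * (d + 1)) + 5 * (m * (d * (d + 1))) +
        2 * (r * (d + 1) * (d + 1))"
      by (simp add: algebra_simps)
    then show "m * (d + 1) * 2 + r * 2 +
        (m * (d + 1) * (2 * (d + 1)) + m * (2 * (d + 1))) +
        m * (3 * d\<^sup>2 + (5 * d + 2) * 1) +
        (r * (2 * (d + 1) + 1) + r * (d + 1) * 3) +
        m * (d + 1) * (5 * (d + 1)) +
        m * (3 * d\<^sup>2 + (5 * d + 2) * (d + 1)) +
        r * (d + 1) * (2 * (d + 1) + 2) \<le> 113 * ?q"
      using q m1 m2 m3 m4 r1 r2 mn rn by linarith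
    show "(\<lambda>i \<theta>. block_res n d (w \<theta>) (p \<theta>) (h \<theta>) i) ` {..<n + 1} \<union>
        (\<lambda>(i, t) \<theta>. block_jac n d (w \<theta>) (p \<theta>) (h \<theta>) i t) ` ({..<n + 1} \<times> {..<d + 1})
      \<subseteq> S1 \<union> S2 \<union> S3 \<union> S4 \<union> S5 \<union> S6 \<union> S7"
      unfolding S4_def S7_def by (auto simp: e_def[abs_def] J_def[abs_def] r_def)
  qed simp
qed

end

theorem corollary6p7:
  shows "\<exists>C::real. \<forall>(ns::nat list) (d::nat). ns \<noteq> [] \<and> d \<le> Min (set ns) \<longrightarrow>
    (\<exists>prog outs.
       real (length prog) \<le> C * (real d ^ 2 * real (sum_list ns)) \<and>
       (\<forall>ps ws h.
          list_all2 (\<lambda>m p. p \<in> carrier_vec (m + 1)) ns ps \<and>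
          list_all2 (\<lambda>m w. w \<in> carrier_vec (m + 1) \<and> (\<forall>j<m + 1. 0 \<le> vec_index w j)) ns ws \<and>
          h \<in> carrier_vec (d + 1) \<and> h \<noteq> 0\<^sub>v (d + 1) \<and>
          (\<forall>k<length ns. full_column_rank (sqrt_diag (ws ! k) * mult_mat (ns ! k - d) h)) \<longrightarrow>
          (\<exists>G J.
             has_gradient (f1 ns d ps ws) G h \<and>
             has_jacobian (g_star ns d ps ws) J h \<and>
             computes prog outs
               (list_of_vec h @ concat (map list_of_vec ps) @ concat (map list_of_vec ws))
               (f1 ns d ps ws h # list_of_vec G @ list_of_vec (g_star ns d ps ws h)
                 @ concat (mat_to_list J)))))"
\<comment> \<open>the blocks take 113, the sum of squares 4 and the gradient 12 units \<open>d\<^sup>2 n\<close>\<close>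
proof (rule exI[of _ 129], intro allI impI)
  fix ns :: "nat list" and d :: nat
  assume nsd: "ns \<noteq> [] \<and> d \<le> Min (set ns)"
  then have d_le: "d \<le> ns ! k" if "k < length ns" for k
    using that by (meson Min_le finite_set nth_mem order_trans)
  define D :: "(real vec list \<times> real vec list \<times> real vec) set" where "D = {(ps, ws, h).
      list_all2 (\<lambda>m p. p \<in> carrier_vec (m + 1)) ns ps \<and>
      list_all2 (\<lambda>m w. w \<in> carrier_vec (m + 1) \<and> (\<forall>j<m + 1. 0 \<le> vec_index w j)) ns ws \<and>
      h \<in> carrier_vec (d + 1) \<and>
      (\<forall>k<length ns. full_column_rank (sqrt_diag (ws ! k) * mult_mat (ns ! k - d) h))}"
  define inp :: "real vec list \<times> real vec list \<times> real vec \<Rightarrow> real list" where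
    "inp = (\<lambda>(ps, ws, h). list_of_vec h @ concat (map list_of_vec ps) @ concat (map list_of_vec ws))"
  define P W H where "P = (fst :: real vec list \<times> real vec list \<times> real vec \<Rightarrow> _)"
    and "W = (\<lambda>\<theta> :: real vec list \<times> real vec list \<times> real vec. fst (snd \<theta>))"
    and "H = (\<lambda>\<theta> :: real vec list \<times> real vec list \<times> real vec. snd (snd \<theta>))"
  define e where "e k i \<theta> = block_res (ns ! k) d (W \<theta> ! k) (P \<theta> ! k) (H \<theta>) i" for k i \<theta>
  define J where "J k i t \<theta> = block_jac (ns ! k) d (W \<theta> ! k) (P \<theta> ! k) (H \<theta>) i t" for k i t \<theta>
  let ?K = "set (entries ns)"
  define f where "f \<theta> = (\<Sum>x\<in>?K. case x of (k, i) \<Rightarrow> e k i \<theta> * e k i \<theta>)" for \<theta>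
  define G where "G t \<theta> = (\<Sum>x\<in>?K. case x of (k, i) \<Rightarrow> 2 * (e k i \<theta> * J k i t \<theta>))" for t \<theta>
  define results where "results = f # map G [0..<d + 1] @ map (\<lambda>(k, i). e k i) (entries ns) @
      concat (map (\<lambda>(k, i). map (J k i) [0..<d + 1]) (entries ns))"

  have adm: "admissible ns d (P \<theta>) (W \<theta>)" and reg: "regular ns d (W \<theta>) (H \<theta>)"
    and len: "length (P \<theta>) = length ns" "length (W \<theta>) = length ns"
    and H_dim: "H \<theta> \<in> carrier_vec (d + 1)" if "\<theta> \<in> D" for \<theta>
    using that d_le
    by (auto simp: D_def P_def W_def H_def admissible_def regular_def regular_block_def
        list_all2_conv_all_nth intro!: full_column_rank_posdef[simplified])

  interpret straight_line D inp .

  define inputs where "inputs = map (\<lambda>t \<theta>. H \<theta> $ t) [0..<d + 1] @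
      map (\<lambda>(k, i) \<theta>. P \<theta> ! k $ i) (entries ns) @ map (\<lambda>(k, i) \<theta>. W \<theta> ! k $ i) (entries ns)"
  have input: "inp \<theta> = map (\<lambda>f. f \<theta>) inputs" if "\<theta> \<in> D" for \<theta>
  proof -
    have "concat (map list_of_vec (P \<theta>)) = map (\<lambda>(k, i). P \<theta> ! k $ i) (entries ns)"
      "concat (map list_of_vec (W \<theta>)) = map (\<lambda>(k, i). W \<theta> ! k $ i) (entries ns)"
      using adm[OF that] len[OF that] by (auto intro!: concat_list_of_vec simp: admissible_def)
    moreover have "list_of_vec (H \<theta>) = map (($) (H \<theta>)) [0..<d + 1]"
      using H_dim[OF that] by (simp add: list_of_vec_map del: upt_Suc)
    ultimately show ?thesis
      by (simp add: inputs_def inp_def P_def W_def H_def case_prod_beta comp_def del: upt_Suc)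
  qed
  have in_h: "derives {} 0 {\<lambda>\<theta>. H \<theta> $ t}" if "t < d + 1" for t
  proof (rule derives_input[OF input])
    have "(\<lambda>\<theta>. H \<theta> $ t) \<in> (\<lambda>t \<theta>. H \<theta> $ t) ` set [0..<d + 1]"
      by (rule imageI) (use that in auto)
    then show "(\<lambda>\<theta>. H \<theta> $ t) \<in> set inputs"
      unfolding inputs_def set_append set_map by blast
  qed
  have in_p: "derives {} 0 {\<lambda>\<theta>. P \<theta> ! k $ i}" and in_w: "derives {} 0 {\<lambda>\<theta>. W \<theta> ! k $ i}"
    if "k < length ns" "i < ns ! k + 1" for k i
  proof -
    have ki: "(k, i) \<in> set (entries ns)"
      using that by (simp add: set_entries)
    have "(\<lambda>\<theta>. P \<theta> ! k $ i) \<in> (\<lambda>(k, i) \<theta>. P \<theta> ! k $ i) ` set (entries ns)"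
      "(\<lambda>\<theta>. W \<theta> ! k $ i) \<in> (\<lambda>(k, i) \<theta>. W \<theta> ! k $ i) ` set (entries ns)"
      by (rule image_eqI[OF _ ki], simp)+
    then have "(\<lambda>\<theta>. P \<theta> ! k $ i) \<in> set inputs" "(\<lambda>\<theta>. W \<theta> ! k $ i) \<in> set inputs"
      unfolding inputs_def set_append set_map by blast+
    then show "derives {} 0 {\<lambda>\<theta>. P \<theta> ! k $ i}" "derives {} 0 {\<lambda>\<theta>. W \<theta> ! k $ i}"
      by (auto intro: derives_input[OF input])
  qed

  have "derives {} (129 * (d\<^sup>2 * sum_list ns)) (set results)"
  proof (cases "d = 0")
    \<comment> \<open>the bound is zero, and all results are the constant zero\<close>
    case True
    have e0: "e k i \<theta> = 0" and J0: "J k i t \<theta> = 0" if "(k, i) \<in> ?K" "\<theta> \<in> D" for k i t \<theta>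
      using that reg[OF that(2)] True
      by (auto simp: e_def J_def regular_def set_entries intro!: square_block_res_zero square_block_jac_zero)
    have "derives {} 0 {g}" if "g \<in> set results" for g
    proof (rule derives_cong[OF derives_zero])
      fix \<theta>
      assume \<theta>: "\<theta> \<in> D"
      show "g \<theta> = 0"
        using that e0[OF _ \<theta>] J0[OF _ \<theta>] by (auto simp: results_def f_def G_def simp del: upt_Suc intro!: sum.neutral)
    qed
    then have "derives {} (\<Sum>g\<in>set results. 0) (\<Union>g\<in>set results. {g})"
      by (intro derives_UN_sum) auto
    then show ?thesis
      using True by simp
  next
    case False
    define S where "S k = e k ` {..<ns ! k + 1} \<union> (\<lambda>(i, t). J k i t) ` ({..<ns ! k + 1} \<times> {..<d + 1})" for k
    have "derives {} (113 * (d\<^sup>2 * ns ! k)) (S k)" if k: "k < length ns" for k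
      unfolding S_def e_def[abs_def] J_def[abs_def]
    proof (rule derives_block)
      show "1 \<le> d" "d \<le> ns ! k" using False d_le[OF k] by auto
      show "derives {} 0 {\<lambda>\<theta>. W \<theta> ! k $ i}" "derives {} 0 {\<lambda>\<theta>. P \<theta> ! k $ i}"
        if "i < ns ! k + 1" for i
        using in_w[OF k that] in_p[OF k that] .
      show "derives {} 0 {\<lambda>\<theta>. H \<theta> $ t}" if "t < d + 1" for t
        using in_h[OF that] .
      show "dim_vec (H \<theta>) = d + 1" if "\<theta> \<in> D" for \<theta>
        using H_dim[OF that] by simp
      show "0 \<le> W \<theta> ! k $ i" if "\<theta> \<in> D" "i < ns ! k + 1" for \<theta> i
        using adm[OF that(1)] that(2) k by (auto simp: admissible_def)
      show "regular_block (ns ! k) d (W \<theta> ! k) (H \<theta>)" if "\<theta> \<in> D" for \<theta>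
        using reg[OF that] k by (auto simp: regular_def)
    qed
    then have "derives {} (\<Sum>k<length ns. 113 * (d\<^sup>2 * ns ! k)) (\<Union>k\<in>{..<length ns}. S k)"
      by (intro derives_UN_sum) auto
    moreover have "(\<Sum>k<length ns. 113 * (d\<^sup>2 * ns ! k)) = 113 * (d\<^sup>2 * sum_list ns)"
      by (simp add: sum_list_sum_nth atLeast0LessThan sum_distrib_left)
    ultimately have blocks: "derives {} (113 * (d\<^sup>2 * sum_list ns)) (\<Union>k\<in>{..<length ns}. S k)"
      by simp
    let ?S = "{} \<union> (\<Union>k\<in>{..<length ns}. S k)"
    have in_e: "derives ?S 0 {e k i}" and in_J: "t < d + 1 \<Longrightarrow> derives ?S 0 {J k i t}"
      if "(k, i) \<in> ?K" for k i t
      using that by (intro derives_stored; force simp: S_def set_entries)+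
    have card: "card ?K \<le> 2 * sum_list ns"
    proof -
      have "card ?K = (\<Sum>k<length ns. ns ! k + 1)"
        unfolding set_entries by (subst card_SigmaI) auto
      also have "\<dots> \<le> (\<Sum>k<length ns. 2 * ns ! k)"
        using d_le False by (intro sum_mono) force
      finally show ?thesis
        by (simp add: sum_list_sum_nth atLeast0LessThan sum_distrib_left)
    qed
    have D: "derives ?S (card ?K * 2) {f}"
      unfolding f_def[abs_def]
    proof (intro derives_sum[where a = 1])
      fix x
      assume x: "x \<in> ?K"
      obtain k i where ki: "x = (k, i)" by fastforce
      have "derives ?S (0 + 0 + 1) {\<lambda>\<theta>. e k i \<theta> * e k i \<theta>}"
        using x ki by (intro derives_mult in_e) auto
      then show "derives ?S 1 {\<lambda>\<theta>. case x of (k, i) \<Rightarrow> e k i \<theta> * e k i \<theta>}"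
        by (simp add: ki)
    qed auto
    have "derives ?S ((d + 1) * (card ?K * 3)) (G ` {..<d + 1})"
    proof (rule derives_image)
      fix t
      assume t: "t \<in> {..<d + 1}"
      show "derives ?S (card ?K * 3) {G t}"
        unfolding G_def[abs_def]
      proof (intro derives_sum[where a = 2])
        fix x
        assume x: "x \<in> ?K"
        obtain k i where ki: "x = (k, i)" by fastforce
        have "derives ?S (0 + (0 + 0 + 1) + 1) {\<lambda>\<theta>. of_int 2 * (e k i \<theta> * J k i t \<theta>)}"
          using x ki t by (intro derives_mult in_e in_J derives_const) auto
        then show "derives ?S 2 {\<lambda>\<theta>. case x of (k, i) \<Rightarrow> 2 * (e k i \<theta> * J k i t \<theta>)}"
          by (simp add: ki numeral_2_eq_2)
      qed auto
    qed auto
    from derives_cut[OF blocks derives_Un[OF D this]] show ?thesis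
    proof (rule derives_weaken)
      have d1: "d + 1 \<le> 2 * d" and dd: "d \<le> d\<^sup>2" "1 \<le> d\<^sup>2"
        using False by (auto simp: power2_eq_square)
      have "(d + 1) * (card ?K * 3) \<le> 2 * d * (2 * sum_list ns * 3)"
        using d1 card by (intro mult_le_mono) auto
      also have "\<dots> = 12 * (d * sum_list ns)" by simp
      also have "\<dots> \<le> 12 * (d\<^sup>2 * sum_list ns)"
        using dd(1) by (intro mult_le_mono) auto
      finally have "(d + 1) * (card ?K * 3) \<le> 12 * (d\<^sup>2 * sum_list ns)" .
      moreover have "sum_list ns \<le> d\<^sup>2 * sum_list ns"
        using dd(2) by simp
      ultimately show "113 * (d\<^sup>2 * sum_list ns) + (card ?K * 2 + (d + 1) * (card ?K * 3))
          \<le> 129 * (d\<^sup>2 * sum_list ns)"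
        using card by linarith
      show "set results \<subseteq> (\<Union>k\<in>{..<length ns}. S k) \<union> ({f} \<union> G ` {..<d + 1})"
        unfolding results_def S_def by (fastforce simp: set_entries simp del: upt_Suc)
    qed simp
  qed
  from derives_computes[OF this] obtain prog outs where len_prog: "length prog \<le> 129 * (d\<^sup>2 * sum_list ns)"
    and comp: "\<forall>\<theta>\<in>D. computes prog outs (inp \<theta>) (map (\<lambda>f. f \<theta>) results)"
    by blast

  show "\<exists>prog outs.
       real (length prog) \<le> 129 * (real d ^ 2 * real (sum_list ns)) \<and>
       (\<forall>ps ws h.
          list_all2 (\<lambda>m p. p \<in> carrier_vec (m + 1)) ns ps \<and>
          list_all2 (\<lambda>m w. w \<in> carrier_vec (m + 1) \<and> (\<forall>j<m + 1. 0 \<le> vec_index w j)) ns ws \<and>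
          h \<in> carrier_vec (d + 1) \<and> h \<noteq> 0\<^sub>v (d + 1) \<and>
          (\<forall>k<length ns. full_column_rank (sqrt_diag (ws ! k) * mult_mat (ns ! k - d) h)) \<longrightarrow>
          (\<exists>G J.
             has_gradient (f1 ns d ps ws) G h \<and>
             has_jacobian (g_star ns d ps ws) J h \<and>
             computes prog outs
               (list_of_vec h @ concat (map list_of_vec ps) @ concat (map list_of_vec ws))
               (f1 ns d ps ws h # list_of_vec G @ list_of_vec (g_star ns d ps ws h)
                 @ concat (mat_to_list J))))"
  proof (intro exI[of _ prog] exI[of _ outs] conjI allI impI)
    have "real (length prog) \<le> real (129 * (d\<^sup>2 * sum_list ns))"
      using len_prog by (rule of_nat_mono)
    then show "real (length prog) \<le> 129 * (real d ^ 2 * real (sum_list ns))"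
      by simp
  next
    fix ps ws :: "real vec list" and h :: "real vec"
    assume data: "list_all2 (\<lambda>m p. p \<in> carrier_vec (m + 1)) ns ps \<and>
      list_all2 (\<lambda>m w. w \<in> carrier_vec (m + 1) \<and> (\<forall>j<m + 1. 0 \<le> vec_index w j)) ns ws \<and>
      h \<in> carrier_vec (d + 1) \<and> h \<noteq> 0\<^sub>v (d + 1) \<and>
      (\<forall>k<length ns. full_column_rank (sqrt_diag (ws ! k) * mult_mat (ns ! k - d) h))"
    define \<theta> where "\<theta> = (ps, ws, h)"
    have \<theta>: "\<theta> \<in> D"
      using data by (auto simp: D_def \<theta>_def)
    have proj: "P \<theta> = ps" "W \<theta> = ws" "H \<theta> = h"
      by (simp_all add: P_def W_def H_def \<theta>_def)
    note ok = adm[OF \<theta>, unfolded proj] reg[OF \<theta>, unfolded proj]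
    let ?G = "vec (d + 1) (\<lambda>t. G t \<theta>)"
    have grad: "has_gradient (f1 ns d ps ws) ?G h"
      using f1_has_gradient[OF ok] by (simp add: G_def e_def J_def proj)
    have jac: "has_jacobian (g_star ns d ps ws) (jacobian ns d ps ws h) h"
      by (rule g_star_has_jacobian[OF ok])
    have result_values: "map (\<lambda>f. f \<theta>) results = f1 ns d ps ws h # list_of_vec ?G @
        list_of_vec (g_star ns d ps ws h) @ concat (mat_to_list (jacobian ns d ps ws h))"
    proof -
      have "f \<theta> = f1 ns d ps ws h"
        unfolding f1_eq_optimal_cost[OF ok] optimal_cost_entries
        by (simp add: f_def e_def proj power2_eq_square)
      moreover have "list_of_vec (g_star ns d ps ws h) = map (\<lambda>(k, i). e k i \<theta>) (entries ns)"
        unfolding list_of_g_star[OF ok] by (simp add: e_def proj)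
      moreover have "concat (mat_to_list (jacobian ns d ps ws h)) =
          concat (map (\<lambda>(k, i). map (\<lambda>t. J k i t \<theta>) [0..<d + 1]) (entries ns))"
        unfolding concat_jacobian by (simp add: J_def proj)
      ultimately show ?thesis
        by (simp add: results_def map_concat comp_def split_def del: upt_Suc)
    qed
    have "computes prog outs
        (list_of_vec h @ concat (map list_of_vec ps) @ concat (map list_of_vec ws))
        (f1 ns d ps ws h # list_of_vec ?G @ list_of_vec (g_star ns d ps ws h)
          @ concat (mat_to_list (jacobian ns d ps ws h)))"
      using bspec[OF comp \<theta>] unfolding result_values by (simp add: inp_def \<theta>_def)
    with grad jac show "\<exists>G J.
        has_gradient (f1 ns d ps ws) G h \<and>
        has_jacobian (g_star ns d ps ws) J h \<and>
        computes prog outs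
          (list_of_vec h @ concat (map list_of_vec ps) @ concat (map list_of_vec ws))
          (f1 ns d ps ws h # list_of_vec G @ list_of_vec (g_star ns d ps ws h)
            @ concat (mat_to_list J))"
      by blast
  qed
qed

end
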